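(* Let $d,s,n$ be positive integers, $f_0^*:\{\pm1\}^s\to\mathbb R$, $S^*\subset[d]$ with $|S^*|=s$, $f^*(\mathbf x)=f_0^*(\mathbf x_{S^*})$. Observe $\mathcal D_n=\{(\mathbf X_i,Y_i)\}_{i=1}^n$, $\mathbf X_i$ i.i.d. uniform on $\{\pm1\}^d$, $Y_i=f^*(\mathbf X_i)+\varepsilon_i$, $\varepsilon_i$ i.i.d. zero-mean independent of covariates and sub-Gaussian with parameter $\sigma$. Suppose $f^*\in\mathsf{SMSP}(\lambda)$, $\lambda>0$. Fix $0<\delta<1$, let $\tau=18(9\|f^*\|_\infty^2+\sigma^2)((s+2)\log3+\log(2d/\delta))$, suppose $n>8\tau/\lambda$, and fit $\hat f_{\mathrm{CART}}$ with minimum impurity decrease threshold $\gamma$ satisfying $\frac\tau n\le\gamma<(\sqrt{\lambda/2}-\sqrt{\tau/n})_+^2$ (such $\gamma$ exists). Then with probability at least $1-\delta-\exp(s\log3-n2^{-s-3})$, $$R(\hat f_{\mathrm{CART}}(\cdot;\mathcal D_n),f^* )\le\frac{2^{s+1}(\|f^*\|_\infty^2+\sigma^2)((s+1)\log3+\log(2/\delta))}{n}.$$ Moreover, under the same conditions with the choice $\delta=1/n$, $\mathfrak R(\hat f_{\mathrm{CART}},f_0^*,d,n)=O\big(2^s(\|f^*\|_\infty^2+\sigma^2)(s+\log n)/n\big)$ with a universal constant.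
   Context: $\mathbf X$ uniform on $\{\pm1\}^d$; $R(g,f^* )=\mathbb E_{\mathbf X}\{(g(\mathbf X)-f^*(\mathbf X))^2\}$, $\mathfrak R=\mathbb E_{\mathcal D_n}R(\hat f(\cdot;\mathcal D_n),f^* )$. Cells: $C=\{\mathbf x:x_j=z_j,\ j\in J(C)\}$; $C_{k,\pm}=C\cap\{x_k=\pm1\}$ for $k\notin J(C)$. $I(C)=\{i:\mathbf X_i\in C\}$, $N(C)=|I(C)|$, $\bar Y_C$ the mean response over $I(C)$, $\mathcal I(C)=\frac1{N(C)}\sum_{i\in I(C)}(Y_i-\bar Y_C)^2$, $\hat\Delta(k;C)=\mathcal I(C)-\frac{N(C_{k,+})}{N(C)}\mathcal I(C_{k,+})-\frac{N(C_{k,-})}{N(C)}\mathcal I(C_{k,-})$. CART grows top-down from $\{\pm1\}^d$: $C$ becomes a leaf if $\frac{N(C)}{n}\max_{k\notin J(C)}\hat\Delta(k;C)<\gamma$, else it is split on $\arg\max_{k\notin J(C)}\hat\Delta(k;C)$; leaves are labeled by mean responses. $f^*\in\mathsf{SMSP}(\lambda)$: for every cell $C$ on which $f^*$ is not constant, $\max_{k\in[d]\setminus J(C)}\operatorname{Cov}^2\{f^*(\mathbf X),X_k\mid\mathbf X\in C\}\,2^{-|J(C)\cap S^*|}\ge\lambda$. *)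

theory Defs
  imports "HOL-Probability.Probability"
begin

text \<open>Points of the hypercube {+-1}^d are extensional functions on the coordinate
  set {0..<d} (coordinates are indexed from 0 instead of 1).\<close>
definition cube :: "nat \<Rightarrow> (nat \<Rightarrow> real) set" where
  "cube d = PiE {..<d} (\<lambda>_. {-1, 1})"

definition restrict_coords :: "nat set \<Rightarrow> nat \<Rightarrow> (nat \<Rightarrow> real) \<Rightarrow> (nat \<Rightarrow> real)" where
  "restrict_coords S s x = (\<lambda>j\<in>{..<s}. x (sorted_list_of_set S ! j))"

definition fstar_of :: "((nat \<Rightarrow> real) \<Rightarrow> real) \<Rightarrow> nat set \<Rightarrow> nat \<Rightarrow> (nat \<Rightarrow> real) \<Rightarrow> real" where
  "fstar_of f0 S s x = f0 (restrict_coords S s x)"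

definition supnorm :: "nat \<Rightarrow> ((nat \<Rightarrow> real) \<Rightarrow> real) \<Rightarrow> real" where
  "supnorm d g = Max ((\<lambda>x. \<bar>g x\<bar>) ` cube d)"

definition risk :: "nat \<Rightarrow> ((nat \<Rightarrow> real) \<Rightarrow> real) \<Rightarrow> ((nat \<Rightarrow> real) \<Rightarrow> real) \<Rightarrow> real" where
  "risk d g f = measure_pmf.expectation (pmf_of_set (cube d)) (\<lambda>x. (g x - f x)^2)"

definition subgaussian_noise :: "real measure \<Rightarrow> real \<Rightarrow> bool" where
  "subgaussian_noise N \<sigma> \<longleftrightarrow>
     prob_space N \<and> sets N = sets borel \<and>
     integrable N (\<lambda>e. e) \<and> (\<integral>e. e \<partial>N) = 0 \<and>
     (\<forall>t::real. integrable N (\<lambda>e. exp (t * e)) \<and>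
                (\<integral>e. exp (t * e) \<partial>N) \<le> exp (\<sigma>^2 * t^2 / 2))"

text \<open>omega i = (X_i, eps_i), i < n, i.i.d. with X_i uniform on the cube, independent of eps_i.\<close>
definition sample_space :: "nat \<Rightarrow> nat \<Rightarrow> real measure \<Rightarrow> (nat \<Rightarrow> (nat \<Rightarrow> real) \<times> real) measure" where
  "sample_space d n N = PiM {..<n} (\<lambda>_. pair_measure (measure_pmf (pmf_of_set (cube d))) N)"

definition dataset :: "((nat \<Rightarrow> real) \<Rightarrow> real) \<Rightarrow> (nat \<Rightarrow> (nat \<Rightarrow> real) \<times> real) \<Rightarrow> nat \<Rightarrow> (nat \<Rightarrow> real) \<times> real" where
  "dataset f \<omega> = (\<lambda>i. (fst (\<omega> i), f (fst (\<omega> i)) + snd (\<omega> i)))"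

text \<open>A cell C = {x : x_j = z_j, j in J(C)} is represented by a partial map c with
  dom c = J(C) and c j = Some z_j.\<close>
definition valid_cell :: "nat \<Rightarrow> (nat \<rightharpoonup> real) \<Rightarrow> bool" where
  "valid_cell d c \<longleftrightarrow> dom c \<subseteq> {..<d} \<and> (\<forall>j\<in>dom c. the (c j) \<in> {-1, 1})"

definition cell_set :: "nat \<Rightarrow> (nat \<rightharpoonup> real) \<Rightarrow> (nat \<Rightarrow> real) set" where
  "cell_set d c = {x \<in> cube d. \<forall>j\<in>dom c. x j = the (c j)}"

definition free_coords :: "nat \<Rightarrow> (nat \<rightharpoonup> real) \<Rightarrow> nat set" where
  "free_coords d c = {..<d} - dom c"

definition cell_idx :: "nat \<Rightarrow> (nat \<Rightarrow> (nat \<Rightarrow> real) \<times> real) \<Rightarrow> (nat \<rightharpoonup> real) \<Rightarrow> nat set" where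
  "cell_idx n D c = {i. i < n \<and> (\<forall>j\<in>dom c. fst (D i) j = the (c j))}"

definition cell_count :: "nat \<Rightarrow> (nat \<Rightarrow> (nat \<Rightarrow> real) \<times> real) \<Rightarrow> (nat \<rightharpoonup> real) \<Rightarrow> nat" where
  "cell_count n D c = card (cell_idx n D c)"

definition mean_resp :: "nat \<Rightarrow> (nat \<Rightarrow> (nat \<Rightarrow> real) \<times> real) \<Rightarrow> (nat \<rightharpoonup> real) \<Rightarrow> real" where
  "mean_resp n D c = (\<Sum>i\<in>cell_idx n D c. snd (D i)) / real (cell_count n D c)"

definition impurity :: "nat \<Rightarrow> (nat \<Rightarrow> (nat \<Rightarrow> real) \<times> real) \<Rightarrow> (nat \<rightharpoonup> real) \<Rightarrow> real" where
  "impurity n D c = (\<Sum>i\<in>cell_idx n D c. (snd (D i) - mean_resp n D c)^2) / real (cell_count n D c)"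

definition imp_dec :: "nat \<Rightarrow> (nat \<Rightarrow> (nat \<Rightarrow> real) \<times> real) \<Rightarrow> (nat \<rightharpoonup> real) \<Rightarrow> nat \<Rightarrow> real" where
  "imp_dec n D c k =
     impurity n D c
     - real (cell_count n D (c(k \<mapsto> 1))) / real (cell_count n D c) * impurity n D (c(k \<mapsto> 1))
     - real (cell_count n D (c(k \<mapsto> -1))) / real (cell_count n D c) * impurity n D (c(k \<mapsto> -1))"

definition max_dec :: "nat \<Rightarrow> nat \<Rightarrow> (nat \<Rightarrow> (nat \<Rightarrow> real) \<times> real) \<Rightarrow> (nat \<rightharpoonup> real) \<Rightarrow> real" where
  "max_dec d n D c = Max (imp_dec n D c ` free_coords d c)"

definition is_leaf :: "nat \<Rightarrow> nat \<Rightarrow> real \<Rightarrow> (nat \<Rightarrow> (nat \<Rightarrow> real) \<times> real) \<Rightarrow> (nat \<rightharpoonup> real) \<Rightarrow> bool" where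
  "is_leaf d n \<gamma> D c \<longleftrightarrow>
     free_coords d c = {} \<or> real (cell_count n D c) / real n * max_dec d n D c < \<gamma>"

definition split_coord :: "nat \<Rightarrow> nat \<Rightarrow> (nat \<Rightarrow> (nat \<Rightarrow> real) \<times> real) \<Rightarrow> (nat \<rightharpoonup> real) \<Rightarrow> nat" where
  "split_coord d n D c = (LEAST k. k \<in> free_coords d c \<and> imp_dec n D c k = max_dec d n D c)"

text \<open>Evaluate the CART tree grown top-down from cell c at point x (fuel = remaining depth).\<close>
fun cart_eval :: "nat \<Rightarrow> nat \<Rightarrow> nat \<Rightarrow> real \<Rightarrow> (nat \<Rightarrow> (nat \<Rightarrow> real) \<times> real) \<Rightarrow> (nat \<rightharpoonup> real)
                  \<Rightarrow> (nat \<Rightarrow> real) \<Rightarrow> real" where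
  "cart_eval 0 d n \<gamma> D c x = mean_resp n D c"
| "cart_eval (Suc m) d n \<gamma> D c x =
     (if is_leaf d n \<gamma> D c then mean_resp n D c
      else (let k = split_coord d n D c in cart_eval m d n \<gamma> D (c(k \<mapsto> x k)) x))"

definition cart :: "nat \<Rightarrow> nat \<Rightarrow> real \<Rightarrow> (nat \<Rightarrow> (nat \<Rightarrow> real) \<times> real) \<Rightarrow> (nat \<Rightarrow> real) \<Rightarrow> real" where
  "cart d n \<gamma> D x = cart_eval d d n \<gamma> D Map.empty x"

definition cond_exp :: "nat \<Rightarrow> (nat \<rightharpoonup> real) \<Rightarrow> ((nat \<Rightarrow> real) \<Rightarrow> real) \<Rightarrow> real" where
  "cond_exp d c g = (\<Sum>x\<in>cell_set d c. g x) / real (card (cell_set d c))"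

definition cond_cov :: "nat \<Rightarrow> (nat \<rightharpoonup> real) \<Rightarrow> ((nat \<Rightarrow> real) \<Rightarrow> real) \<Rightarrow> nat \<Rightarrow> real" where
  "cond_cov d c g k = cond_exp d c (\<lambda>x. g x * x k) - cond_exp d c g * cond_exp d c (\<lambda>x. x k)"

definition SMSP :: "nat \<Rightarrow> nat set \<Rightarrow> ((nat \<Rightarrow> real) \<Rightarrow> real) \<Rightarrow> real \<Rightarrow> bool" where
  "SMSP d S f lam \<longleftrightarrow>
     (\<forall>c. valid_cell d c \<longrightarrow> \<not> (\<exists>a. \<forall>x\<in>cell_set d c. f x = a) \<longrightarrow>
        Max ((\<lambda>k. (cond_cov d c f k)^2 * 2 powr (- real (card (dom c \<inter> S)))) ` free_coords d c)
          \<ge> lam)"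

definition model_setting :: "nat \<Rightarrow> nat \<Rightarrow> nat \<Rightarrow> ((nat \<Rightarrow> real) \<Rightarrow> real) \<Rightarrow> nat set
                                \<Rightarrow> real measure \<Rightarrow> real \<Rightarrow> real \<Rightarrow> bool" where
  "model_setting d s n f0 S N \<sigma> lam \<longleftrightarrow>
     0 < d \<and> 0 < s \<and> 0 < n \<and> S \<subseteq> {..<d} \<and> card S = s \<and>
     subgaussian_noise N \<sigma> \<and> 0 < lam \<and> SMSP d S (fstar_of f0 S s) lam"

definition tau :: "nat \<Rightarrow> nat \<Rightarrow> real \<Rightarrow> real \<Rightarrow> real \<Rightarrow> real" where
  "tau d s fnorm \<sigma> \<delta> = 18 * (9 * fnorm^2 + \<sigma>^2) * ((real s + 2) * ln 3 + ln (2 * real d / \<delta>))"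

end

theory Submission
  imports Defs
begin

text \<open>
  Multiplying the impurity decrease of a split by the cell count gives the two-sample statistic
  \<open>N_+ N_- / N\<close> times the squared difference of the child means. Conditionally on which
  observations fall into which child, this is the square of a unit-norm linear combination of the
  responses, so with high probability it is within \<open>sqrt tau\<close> (on the square-root scale) of its
  population analogue for all \<open>3^s\<close> cells cut out by relevant coordinates and all \<open>d\<close> splits.
  The population analogue vanishes for irrelevant coordinates and for cells on which \<open>f*\<close> is
  constant; on the other cells SMSP makes it large for some coordinate. Hence the tree splits
  exactly the cells on which \<open>f*\<close> is not constant, always along relevant coordinates, and the error
  at a point is the average noise in its leaf.

  The sharp constant in the leaf error comes from two observations. A non-root leaf has a parent on
  which \<open>f*\<close> varies, so SMSP and the lower bound on \<open>n\<close> force the expected leaf count to be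
  large compared with \<open>tau\<close>. And the event that the noise sum exceeds \<open>t\<close> times the random leaf
  count is bounded by one Chernoff bound that treats count and noise jointly; its small loss is
  absorbed by the slack between \<open>sigma^2\<close> and \<open>B^2 + sigma^2\<close>.
\<close>

section \<open>Tail bounds for product measures\<close>

text \<open>The obstacle is that the data which define the error also choose the cells. It is
  removed by deviation bounds that hold simultaneously over a family fixed in advance. An induction
  down the tree, run on the good event, shows that growth never leaves this family. Child counts are
  bounded below only for splits that SMSP certifies as informative. For these, the bound
  \<open>B\<close> on the covariance turns \<open>n * lam > 8 * \<tau>\<close> into an expected
  parent count above \<open>1296 * Lt\<close>, so failures of the count bounds are charged to
  \<open>\<delta>\<close> as well. The charges are \<delta>/9 for split statistics, \<delta>/9 for
  counts and \<delta>/3 for leaf noise, and the argument reaches probability 1 - \<delta>. The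
  variance proxy \<open>B^2 + \<sigma>^2\<close> may be 0, and then Chernoff parameters of the form
  t / v are meaningless. In that case \<open>f\<close> vanishes on the cube and the noise is almost
  surely 0, so it is handled directly.\<close>

lemma emeasure_le_nn_integral:
  assumes "\<And>x. x \<in> E \<Longrightarrow> x \<in> space M \<Longrightarrow> 1 \<le> g x"
  shows "emeasure M E \<le> (\<integral>\<^sup>+x. g x \<partial>M)"
proof (cases "E \<in> sets M")
  case True
  then have "emeasure M E = (\<integral>\<^sup>+x. indicator E x \<partial>M)"
    by simp
  also have "\<dots> \<le> (\<integral>\<^sup>+x. g x \<partial>M)"
    using assms by (intro nn_integral_mono) (auto simp: indicator_def)
  finally show ?thesis .
qed (simp add: emeasure_notin_sets)

text \<open>Markov's inequality for the exponential of the sum, with independence turning the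
  expectation into a product. The exponential parameter is part of \<open>\<phi>\<close>, so the
  event always has threshold 0.\<close>

lemma iid_chernoff:
  fixes \<phi> :: "'a \<Rightarrow> real"
  assumes Q: "prob_space Q" and [measurable]: "\<phi> \<in> borel_measurable Q"
    and mgf: "(\<integral>\<^sup>+z. ennreal (exp (\<phi> z)) \<partial>Q) \<le> ennreal B" and B: "0 \<le> B"
  shows "measure (PiM {..<n} (\<lambda>_. Q)) {\<omega> \<in> space (PiM {..<n} (\<lambda>_. Q)). 0 \<le> (\<Sum>i<n. \<phi> (\<omega> i))} \<le> B ^ n"
proof -
  interpret Q: prob_space Q by fact
  interpret product_prob_space "\<lambda>_. Q" "{..<n}" by unfold_locales
  let ?M = "PiM {..<n} (\<lambda>_. Q)"
  let ?E = "{\<omega> \<in> space ?M. 0 \<le> (\<Sum>i<n. \<phi> (\<omega> i))}"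
  have "emeasure ?M ?E \<le> (\<integral>\<^sup>+\<omega>. (\<Prod>i<n. ennreal (exp (\<phi> (\<omega> i)))) \<partial>?M)"
    by (rule emeasure_le_nn_integral) (simp add: prod_ennreal exp_sum[symmetric])
  also have "\<dots> = (\<Prod>i<n. \<integral>\<^sup>+z. ennreal (exp (\<phi> z)) \<partial>Q)"
    by (rule product_nn_integral_prod) auto
  also have "\<dots> \<le> (\<Prod>i<n. ennreal B)"
    by (intro prod_mono_ennreal mgf)
  also have "\<dots> = ennreal (B ^ n)"
    using B by (simp add: ennreal_power)
  finally show ?thesis
    using B by (simp add: emeasure_eq_measure)
qed

text \<open>Weights that depend on the data only through the labels can be treated as constants:
  decompose the expectation over the finitely many label vectors.\<close>
lemma labelled_subgaussian_tail:
  fixes lab :: "'a \<Rightarrow> 'b" and h :: "'a \<Rightarrow> real" and W :: "(nat \<Rightarrow> 'b) \<Rightarrow> nat \<Rightarrow> real"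
  assumes Q: "prob_space Q" and [measurable]: "h \<in> borel_measurable Q"
    and lab[measurable]: "lab \<in> Q \<rightarrow>\<^sub>M count_space UNIV"
    and fin: "finite Lab" and labs: "\<And>z. z \<in> space Q \<Longrightarrow> lab z \<in> Lab"
    and v: "0 < v" and r: "0 \<le> r"
    and mgf: "\<And>a l. l \<in> Lab \<Longrightarrow> (\<integral>\<^sup>+z. ennreal (exp (a * h z)) * indicator {z. lab z = l} z \<partial>Q)
        \<le> ennreal (exp (a\<^sup>2 * v / 2)) * emeasure Q {z \<in> space Q. lab z = l}"
    and W: "\<And>l. l \<in> PiE {..<n} (\<lambda>_. Lab) \<Longrightarrow> (\<Sum>i<n. (W l i)\<^sup>2) \<le> 1"
  shows "measure (PiM {..<n} (\<lambda>_. Q)) {\<omega> \<in> space (PiM {..<n} (\<lambda>_. Q)).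
     r \<le> (\<Sum>i<n. W (\<lambda>i\<in>{..<n}. lab (\<omega> i)) i * h (\<omega> i))} \<le> exp (- r\<^sup>2 / (2 * v))"
proof -
  interpret Q: prob_space Q by fact
  interpret product_prob_space "\<lambda>_. Q" "{..<n}" by unfold_locales
  let ?M = "PiM {..<n} (\<lambda>_. Q)"
  define E where "E = {\<omega> \<in> space ?M. r \<le> (\<Sum>i<n. W (\<lambda>i\<in>{..<n}. lab (\<omega> i)) i * h (\<omega> i))}"
  let ?q = "\<lambda>l. emeasure Q {z \<in> space Q. lab z = l}"
  \<comment> \<open>Minimiser of the Chernoff exponent a^2 * v / 2 - a * r.\<close>
  define a where "a = r / v"
  define g where "g = (\<lambda>l i z. ennreal (exp (a * W l i * h z)) * indicator {z. lab z = l i} z)"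
  have gm: "g l i \<in> borel_measurable Q" for l i
    unfolding g_def indicator_def of_bool_def by measurable
  have gm2: "(\<lambda>x. g l i (x i)) \<in> borel_measurable ?M" if "i < n" for l i
  proof -
    have "i \<in> {..<n}" using that by simp
    then show ?thesis using gm[measurable] by measurable
  qed
  have a: "0 \<le> a" "a\<^sup>2 * v / 2 - a * r = - r\<^sup>2 / (2 * v)"
    using v r by (auto simp: a_def field_simps power2_eq_square)
  \<comment> \<open>Only the label vector realised by \<open>\<omega>\<close> survives the
    indicators, so the sum over all label vectors dominates the exponential of the statistic. In
    each summand the weights are constants, hence the integral factorises.\<close>
  have one: "1 \<le> ennreal (exp (- a * r)) * (\<Sum>l\<in>PiE {..<n} (\<lambda>_. Lab). \<Prod>i<n. g l i (\<omega> i))"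
    if \<omega>: "\<omega> \<in> E" "\<omega> \<in> space ?M" for \<omega>
  proof -
    define L where "L = (\<lambda>i\<in>{..<n}. lab (\<omega> i))"
    have L: "L \<in> PiE {..<n} (\<lambda>_. Lab)"
      using \<omega>(2) labs by (auto simp: L_def space_PiM)
    have "(\<Prod>i<n. g L i (\<omega> i)) = (\<Prod>i<n. ennreal (exp (a * W L i * h (\<omega> i))))"
      by (intro prod.cong) (auto simp: g_def L_def)
    also have "\<dots> = ennreal (exp (a * (\<Sum>i<n. W L i * h (\<omega> i))))"
      by (simp add: prod_ennreal exp_sum[symmetric] sum_distrib_left mult.assoc)
    also have "ennreal (exp (a * r)) \<le> \<dots>"
      using \<omega>(1) a by (intro ennreal_leI) (auto simp: L_def E_def intro: mult_left_mono)
    finally have "ennreal (exp (- a * r)) * ennreal (exp (a * r))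
        \<le> ennreal (exp (- a * r)) * (\<Prod>i<n. g L i (\<omega> i))"
      by (intro mult_left_mono) auto
    also have "\<dots> \<le> ennreal (exp (- a * r)) * (\<Sum>l\<in>PiE {..<n} (\<lambda>_. Lab). \<Prod>i<n. g l i (\<omega> i))"
      using L fin by (intro mult_left_mono member_le_sum finite_PiE) auto
    finally show ?thesis
      by (simp add: ennreal_mult'[symmetric] exp_add[symmetric])
  qed
  have "emeasure ?M E
      \<le> (\<integral>\<^sup>+\<omega>. ennreal (exp (- a * r)) * (\<Sum>l\<in>PiE {..<n} (\<lambda>_. Lab). \<Prod>i<n. g l i (\<omega> i)) \<partial>?M)"
    by (rule emeasure_le_nn_integral) (rule one)
  also have "\<dots> = ennreal (exp (- a * r)) * (\<Sum>l\<in>PiE {..<n} (\<lambda>_. Lab). \<integral>\<^sup>+\<omega>. (\<Prod>i<n. g l i (\<omega> i)) \<partial>?M)"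
    by (subst nn_integral_cmult)
       (auto intro!: borel_measurable_sum borel_measurable_prod_ennreal gm2 nn_integral_sum
          arg_cong2[where f="(*)"])
  also have "(\<Sum>l\<in>PiE {..<n} (\<lambda>_. Lab). \<integral>\<^sup>+\<omega>. (\<Prod>i<n. g l i (\<omega> i)) \<partial>?M)
      = (\<Sum>l\<in>PiE {..<n} (\<lambda>_. Lab). \<Prod>i<n. \<integral>\<^sup>+z. g l i z \<partial>Q)"
    by (intro sum.cong refl product_nn_integral_prod gm) auto
  also have "\<dots> \<le> (\<Sum>l\<in>PiE {..<n} (\<lambda>_. Lab). ennreal (exp (a\<^sup>2 * v / 2)) * (\<Prod>i<n. ?q (l i)))"
  proof (rule sum_mono)
    fix l assume l: "l \<in> PiE {..<n} (\<lambda>_. Lab)"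
    have "(\<Prod>i<n. \<integral>\<^sup>+z. g l i z \<partial>Q) \<le> (\<Prod>i<n. ennreal (exp ((a * W l i)\<^sup>2 * v / 2)) * ?q (l i))"
      unfolding g_def using l by (intro prod_mono_ennreal mgf) auto
    also have "\<dots> = ennreal (exp (a\<^sup>2 * v / 2 * (\<Sum>i<n. (W l i)\<^sup>2))) * (\<Prod>i<n. ?q (l i))"
      by (simp add: prod.distrib prod_ennreal exp_sum[symmetric] sum_distrib_left power_mult_distrib
          sum_divide_distrib mult_ac)
    also have "\<dots> \<le> ennreal (exp (a\<^sup>2 * v / 2)) * (\<Prod>i<n. ?q (l i))"
      using W[OF l] v by (intro mult_right_mono ennreal_leI) (auto intro!: mult_left_le)
    finally show "(\<Prod>i<n. \<integral>\<^sup>+z. g l i z \<partial>Q) \<le> ennreal (exp (a\<^sup>2 * v / 2)) * (\<Prod>i<n. ?q (l i))" .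
  qed
  \<comment> \<open>The exponential factor no longer depends on the labels; what remains sums to the
    total mass 1 of the label distribution.\<close>
  also have "\<dots> = ennreal (exp (a\<^sup>2 * v / 2)) * (\<Prod>i<n. \<Sum>l\<in>Lab. ?q l)"
    using fin by (subst prod_sum_PiE) (auto simp: sum_distrib_left)
  also have "(\<Sum>l\<in>Lab. ?q l) = emeasure Q (\<Union>l\<in>Lab. {z \<in> space Q. lab z = l})"
    using fin by (intro sum_emeasure) (auto simp: disjoint_family_on_def)
  also have "(\<Union>l\<in>Lab. {z \<in> space Q. lab z = l}) = space Q"
    using labs by auto
  finally have "emeasure ?M E \<le> ennreal (exp (- a * r)) * ennreal (exp (a\<^sup>2 * v / 2))"
    by (simp add: Q.emeasure_space_1 mult_left_mono)
  also have "\<dots> = ennreal (exp (- r\<^sup>2 / (2 * v)))"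
    using a(2) by (simp add: ennreal_mult'[symmetric] exp_add[symmetric] algebra_simps)
  finally show ?thesis
    unfolding E_def[symmetric] by (simp add: emeasure_eq_measure)
qed

section \<open>Cells of the cube\<close>

lemma finite_cube [simp]: "finite (cube d)"
  by (simp add: cube_def finite_PiE)

lemma card_cube: "card (cube d) = 2 ^ d"
  by (simp add: cube_def card_PiE numeral_2_eq_2)

lemma cube_nonempty [simp]: "cube d \<noteq> {}"
  using card_cube[of d] by fastforce

lemma cube_coord: "x \<in> cube d \<Longrightarrow> j < d \<Longrightarrow> x j = 1 \<or> x j = - 1"
  by (auto simp: cube_def PiE_iff)

lemma cell_set_subset: "cell_set d c \<subseteq> cube d"
  by (auto simp: cell_set_def)

lemma finite_cell_set [simp]: "finite (cell_set d c)"
  using finite_subset[OF cell_set_subset] by auto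

lemma finite_free_coords [simp]: "finite (free_coords d c)"
  by (simp add: free_coords_def)

lemma valid_cell_upd:
  "valid_cell d c \<Longrightarrow> k < d \<Longrightarrow> z = 1 \<or> z = - 1 \<Longrightarrow> valid_cell d (c(k \<mapsto> z))"
  by (auto simp: valid_cell_def)

lemma finite_dom_valid_cell: "valid_cell d c \<Longrightarrow> finite (dom c)"
  by (auto simp: valid_cell_def intro: finite_subset)

lemma card_dom_valid_cell: "valid_cell d c \<Longrightarrow> card (dom c) \<le> d"
  by (auto simp: valid_cell_def dest: card_mono[rotated])

text \<open>A cell is a product set, with one choice per fixed coordinate and two per free one.
  Written with a power of 1/2, the formula displays the probability of the cell after division by
  2^d.\<close>

lemma card_cell_set:
  assumes c: "valid_cell d c"
  shows "real (card (cell_set d c)) = 2 ^ d * (1 / 2) ^ card (dom c)"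
proof -
  have "cell_set d c = PiE {..<d} (\<lambda>j. case c j of None \<Rightarrow> {-1, 1} | Some z \<Rightarrow> {z})" (is "_ = PiE _ ?B")
  proof (intro set_eqI iffI)
    fix x assume "x \<in> cell_set d c"
    then have "x \<in> PiE {..<d} (\<lambda>_. {-1, 1})" "\<And>j z. c j = Some z \<Longrightarrow> x j = z"
      by (force simp: cell_set_def cube_def)+
    then show "x \<in> PiE {..<d} ?B"
      by (simp add: PiE_iff split: option.split)
  next
    fix x assume x: "x \<in> PiE {..<d} ?B"
    have "x j = the (c j)" if "j \<in> dom c" for j
    proof -
      have "j < d" using c that by (auto simp: valid_cell_def)
      then have "x j \<in> ?B j" using x by (auto simp: PiE_iff)
      then show ?thesis using that by auto
    qed
    moreover have "x j \<in> {-1, 1}" if "j < d" for j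
    proof (cases "c j")
      case None
      then show ?thesis using x that by (force simp: PiE_iff)
    next
      case (Some z)
      then have "the (c j) \<in> {-1, 1}" using c by (force simp: valid_cell_def)
      then show ?thesis using calculation[of j] Some by auto
    qed
    moreover have "x \<in> extensional {..<d}" using x by (auto simp: PiE_iff)
    ultimately show "x \<in> cell_set d c" by (auto simp: cell_set_def cube_def PiE_iff)
  qed
  then have "card (cell_set d c) = (\<Prod>j<d. card (?B j))"
    by (simp add: card_PiE)
  also have "\<dots> = (\<Prod>j\<in>dom c. card (?B j)) * (\<Prod>j\<in>{..<d} - dom c. card (?B j))"
    using c by (subst prod.subset_diff[of "dom c"]) (auto simp: valid_cell_def)
  also have "(\<Prod>j\<in>dom c. card (?B j)) = 1"
    by (intro prod.neutral) auto
  also have "(\<Prod>j\<in>{..<d} - dom c. card (?B j)) = (\<Prod>j\<in>{..<d} - dom c. 2)"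
    by (intro prod.cong) (auto simp: dom_def)
  also have "\<dots> = 2 ^ (d - card (dom c))"
    using c finite_dom_valid_cell[OF c] by (simp add: card_Diff_subset valid_cell_def)
  finally have "card (cell_set d c) = 2 ^ (d - card (dom c))" by simp
  then have "real (card (cell_set d c)) = 2 ^ (d - card (dom c))" by simp
  also have "\<dots> = 2 ^ d * (1 / 2) ^ card (dom c)"
    using card_dom_valid_cell[OF c] by (simp add: power_diff power_one_over)
  finally show ?thesis .
qed

lemma cell_set_nonempty: "valid_cell d c \<Longrightarrow> cell_set d c \<noteq> {}"
  using card_cell_set[of d c] by auto

lemma cell_set_upd:
  assumes "k \<in> free_coords d c"
  shows "cell_set d (c(k \<mapsto> z)) = {x \<in> cell_set d c. x k = z}"
  using assms by (auto simp: cell_set_def free_coords_def)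

lemma cell_set_split:
  assumes "k \<in> free_coords d c"
  shows "cell_set d c = cell_set d (c(k \<mapsto> 1)) \<union> cell_set d (c(k \<mapsto> - 1))"
    "cell_set d (c(k \<mapsto> 1)) \<inter> cell_set d (c(k \<mapsto> - 1)) = {}"
  using assms cube_coord[of _ d k] unfolding cell_set_upd[OF assms]
  by (auto simp: cell_set_def free_coords_def)

lemma card_dom_upd:
  "valid_cell d c \<Longrightarrow> k \<in> free_coords d c \<Longrightarrow> card (dom (c(k \<mapsto> z))) = Suc (card (dom c))"
  by (simp add: free_coords_def finite_dom_valid_cell)

lemma card_cell_set_upd:
  assumes "valid_cell d c" "k \<in> free_coords d c" "z = 1 \<or> z = - 1"
  shows "real (card (cell_set d (c(k \<mapsto> z)))) = real (card (cell_set d c)) / 2"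
proof -
  have "valid_cell d (c(k \<mapsto> z))"
    using assms by (intro valid_cell_upd) (auto simp: free_coords_def)
  then show ?thesis
    using assms card_cell_set[of d c] card_cell_set[of d "c(k \<mapsto> z)"] card_dom_upd[of d c k z] by simp
qed

text \<open>On the cell, coordinate \<open>k\<close> is a sign with mean zero. This translates the
  covariances of SMSP into the gaps between child means that drive the impurity decrease.\<close>

lemma cond_cov_eq:
  assumes c: "valid_cell d c" and k: "k \<in> free_coords d c"
  shows "cond_cov d c g k = (cond_exp d (c(k \<mapsto> 1)) g - cond_exp d (c(k \<mapsto> - 1)) g) / 2"
proof -
  let ?P = "cell_set d (c(k \<mapsto> 1))" and ?M = "cell_set d (c(k \<mapsto> - 1))"
  have split: "(\<Sum>x\<in>cell_set d c. u x * x k) = (\<Sum>x\<in>?P. u x) - (\<Sum>x\<in>?M. u x)" for u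
  proof -
    have "(\<Sum>x\<in>cell_set d c. u x * x k) = (\<Sum>x\<in>?P. u x * x k) + (\<Sum>x\<in>?M. u x * x k)"
      using cell_set_split[OF k] by (simp add: sum.union_disjoint)
    also have "(\<Sum>x\<in>?P. u x * x k) = (\<Sum>x\<in>?P. u x)"
      by (intro sum.cong) (auto simp: cell_set_upd[OF k])
    also have "(\<Sum>x\<in>?M. u x * x k) = (\<Sum>x\<in>?M. - u x)"
      by (intro sum.cong) (auto simp: cell_set_upd[OF k])
    finally show ?thesis by (simp only: sum_negf diff_conv_add_uminus)
  qed
  have "(\<Sum>x\<in>cell_set d c. x k) = 0"
    using split[of "\<lambda>_. 1"] card_cell_set_upd[OF c k, of 1] card_cell_set_upd[OF c k, of "- 1"] by simp
  then have "cond_cov d c g k = (\<Sum>x\<in>cell_set d c. g x * x k) / card (cell_set d c)"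
    by (simp add: cond_cov_def cond_exp_def)
  also have "\<dots> = (cond_exp d (c(k \<mapsto> 1)) g - cond_exp d (c(k \<mapsto> - 1)) g) / 2"
    using card_cell_set_upd[OF c k, of 1] card_cell_set_upd[OF c k, of "- 1"]
    by (simp add: split cond_exp_def diff_divide_distrib)
  finally show ?thesis .
qed

lemma cond_exp_const:
  assumes "valid_cell d c" "\<And>x. x \<in> cell_set d c \<Longrightarrow> g x = a"
  shows "cond_exp d c g = a"
  using assms cell_set_nonempty[of d c] by (simp add: cond_exp_def)

lemma cond_exp_abs_le:
  assumes "valid_cell d c" "\<And>x. x \<in> cube d \<Longrightarrow> \<bar>g x\<bar> \<le> b"
  shows "\<bar>cond_exp d c g\<bar> \<le> b"
proof -
  have "\<bar>\<Sum>x\<in>cell_set d c. g x\<bar> \<le> real (card (cell_set d c)) * b"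
    using assms(2) cell_set_subset[of d c]
    by (intro order.trans[OF sum_abs] sum_bounded_above) auto
  moreover have "card (cell_set d c) > 0"
    using cell_set_nonempty[OF assms(1)] by (simp add: card_gt_0_iff)
  ultimately show ?thesis
    by (simp add: cond_exp_def abs_divide field_simps)
qed

lemma cond_cov_abs_le:
  assumes "valid_cell d c" "k \<in> free_coords d c" "\<And>x. x \<in> cube d \<Longrightarrow> \<bar>g x\<bar> \<le> b"
  shows "\<bar>cond_cov d c g k\<bar> \<le> b"
proof -
  have "valid_cell d (c(k \<mapsto> z))" if "z = 1 \<or> z = - 1" for z
    using assms that by (intro valid_cell_upd) (auto simp: free_coords_def)
  then have "\<bar>cond_exp d (c(k \<mapsto> 1)) g\<bar> \<le> b" "\<bar>cond_exp d (c(k \<mapsto> - 1)) g\<bar> \<le> b"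
    using assms(3) by (auto intro!: cond_exp_abs_le)
  then show ?thesis
    by (simp add: cond_cov_eq[OF assms(1,2)])
qed

text \<open>Flipping coordinate \<open>k\<close> maps one child onto the other and preserves
  \<open>g\<close>.\<close>

lemma cond_exp_irrelevant:
  assumes c: "valid_cell d c" and k: "k \<in> free_coords d c"
    and irr: "\<And>x z. x \<in> cube d \<Longrightarrow> g (x(k := z)) = g x"
  shows "cond_exp d (c(k \<mapsto> 1)) g = cond_exp d (c(k \<mapsto> - 1)) g"
proof -
  have kd: "k < d" "k \<notin> dom c" using k by (auto simp: free_coords_def)
  have "(\<Sum>x\<in>cell_set d (c(k \<mapsto> 1)). g x) = (\<Sum>x\<in>cell_set d (c(k \<mapsto> - 1)). g x)"
    by (rule sum.reindex_bij_witness[of _ "\<lambda>x. x(k := 1)" "\<lambda>x. x(k := - 1)"])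
       (use kd irr in \<open>auto simp: cell_set_def cube_def PiE_iff extensional_def fun_eq_iff\<close>)
  then show ?thesis
    using card_cell_set_upd[OF c k, of 1] card_cell_set_upd[OF c k, of "- 1"]
    by (simp add: cond_exp_def)
qed

lemma abs_le_supnorm: "x \<in> cube d \<Longrightarrow> \<bar>g x\<bar> \<le> supnorm d g"
  by (auto simp: supnorm_def)

lemma supnorm_nonneg: "0 \<le> supnorm d g"
proof -
  obtain x where "x \<in> cube d" using cube_nonempty by blast
  then show ?thesis using abs_le_supnorm[of x d g] by linarith
qed

lemma fstar_of_cong:
  assumes "finite S" "card S = s" "\<And>j. j \<in> S \<Longrightarrow> x j = y j"
  shows "fstar_of f0 S s x = fstar_of f0 S s y"
proof -
  have "sorted_list_of_set S ! j \<in> S" if "j < s" for j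
    using nth_mem[of j "sorted_list_of_set S"] assms that by simp
  then show ?thesis
    using assms(3) unfolding fstar_of_def restrict_coords_def
    by (intro arg_cong[where f=f0]) (auto simp: restrict_def)
qed

text \<open>The family fixed in advance for the union bounds: each coordinate of \<open>S\<close> is
  free, +1 or -1, which is where the \<open>s * ln 3\<close> in the logarithmic factors comes
  from.\<close>

definition relevant_cells :: "nat set \<Rightarrow> (nat \<rightharpoonup> real) set" where
  "relevant_cells S = {c. dom c \<subseteq> S \<and> ran c \<subseteq> {-1, 1}}"

text \<open>Outside \<open>S\<close> these partial maps are \<open>None\<close>, so restriction to
  \<open>S\<close> is injective into functions with three possible values.\<close>

lemma finite_relevant_cells: "finite S \<Longrightarrow> finite (relevant_cells S)"
  and card_relevant_cells: "finite S \<Longrightarrow> card (relevant_cells S) \<le> 3 ^ card S"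
proof -
  assume S: "finite S"
  let ?B = "PiE S (\<lambda>_. {None, Some (-1), Some (1::real)})"
  have inj: "inj_on (\<lambda>c. restrict c S) (relevant_cells S)"
  proof (rule inj_onI, rule ext)
    fix c c' j assume h: "c \<in> relevant_cells S" "c' \<in> relevant_cells S" "restrict c S = restrict c' S"
    show "c j = c' j"
    proof (cases "j \<in> S")
      case True then show ?thesis using fun_cong[OF h(3), of j] by simp
    next
      case False
      then have "j \<notin> dom c" "j \<notin> dom c'" using h by (auto simp: relevant_cells_def)
      then show ?thesis by (simp add: domIff)
    qed
  qed
  have sub: "(\<lambda>c. restrict c S) ` relevant_cells S \<subseteq> ?B"
  proof
    fix g assume "g \<in> (\<lambda>c. restrict c S) ` relevant_cells S"
    then obtain c where c: "c \<in> relevant_cells S" "g = restrict c S" by auto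
    have "c j \<in> {None, Some (- 1), Some 1}" for j
      using c(1) by (cases "c j") (auto simp: relevant_cells_def dest: ranI)
    then show "g \<in> ?B" using c(2) by simp
  qed
  have B: "finite ?B" "card ?B = 3 ^ card S"
    using S by (auto simp: finite_PiE card_PiE numeral_3_eq_3)
  show "finite (relevant_cells S)"
    using inj_on_finite[OF inj sub B(1)] .
  show "card (relevant_cells S) \<le> 3 ^ card S"
    using card_inj_on_le[OF inj sub B(1)] B(2) by simp
qed

lemma valid_relevant_cell: "c \<in> relevant_cells S \<Longrightarrow> S \<subseteq> {..<d} \<Longrightarrow> valid_cell d c"
  by (force simp: relevant_cells_def valid_cell_def dest: ranI)

lemma relevant_cells_upd:
  "c \<in> relevant_cells S \<Longrightarrow> k \<in> S \<Longrightarrow> z = 1 \<or> z = - 1 \<Longrightarrow> c(k \<mapsto> z) \<in> relevant_cells S"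
  by (auto simp: relevant_cells_def ran_def split: if_splits)

lemma empty_relevant_cell: "Map.empty \<in> relevant_cells S"
  by (simp add: relevant_cells_def)

section \<open>Tree growth on a good sample\<close>

lemma finite_cell_idx [simp]: "finite (cell_idx n D c)"
  by (simp add: cell_idx_def)

lemma cell_idx_upd:
  assumes "k \<notin> dom c"
  shows "cell_idx n D (c(k \<mapsto> z)) = {i \<in> cell_idx n D c. fst (D i) k = z}"
  using assms by (auto simp: cell_idx_def)

lemma cell_idx_split:
  assumes "\<And>i. i < n \<Longrightarrow> fst (D i) \<in> cube d" "k \<in> free_coords d c"
  shows "cell_idx n D c = cell_idx n D (c(k \<mapsto> 1)) \<union> cell_idx n D (c(k \<mapsto> - 1))"
    "cell_idx n D (c(k \<mapsto> 1)) \<inter> cell_idx n D (c(k \<mapsto> - 1)) = {}"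
proof -
  have k: "k \<notin> dom c" "k < d" using assms(2) by (auto simp: free_coords_def)
  have "fst (D i) k = 1 \<or> fst (D i) k = - 1" if "i \<in> cell_idx n D c" for i
    using that cube_coord[OF assms(1) k(2)] by (auto simp: cell_idx_def)
  then show "cell_idx n D c = cell_idx n D (c(k \<mapsto> 1)) \<union> cell_idx n D (c(k \<mapsto> - 1))"
    "cell_idx n D (c(k \<mapsto> 1)) \<inter> cell_idx n D (c(k \<mapsto> - 1)) = {}"
    unfolding cell_idx_upd[OF k(1)] by auto
qed

text \<open>The sum of squares about the mean, expanded. For an empty cell both sides are 0 since
  division by 0 gives 0.\<close>

lemma count_times_impurity:
  "real (cell_count n D c) * impurity n D c
    = (\<Sum>i\<in>cell_idx n D c. (snd (D i))\<^sup>2) - (\<Sum>i\<in>cell_idx n D c. snd (D i))\<^sup>2 / real (cell_count n D c)"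
proof (cases "cell_count n D c = 0")
  case True
  then have "cell_idx n D c = {}" by (simp add: cell_count_def)
  then show ?thesis by (simp add: True)
next
  case False
  let ?I = "cell_idx n D c" and ?N = "real (cell_count n D c)"
  define A m where "A = (\<Sum>i\<in>?I. snd (D i))" and "m = mean_resp n D c"
  have m: "m = A / ?N" by (simp add: m_def A_def mean_resp_def)
  have "?N * impurity n D c = (\<Sum>i\<in>?I. (snd (D i) - m)\<^sup>2)"
    using False by (simp add: impurity_def m_def)
  also have "\<dots> = (\<Sum>i\<in>?I. (snd (D i))\<^sup>2 - 2 * m * snd (D i) + m\<^sup>2)"
    by (simp add: power2_diff algebra_simps)
  also have "\<dots> = (\<Sum>i\<in>?I. (snd (D i))\<^sup>2) - 2 * m * A + ?N * m\<^sup>2"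
    by (simp add: sum.distrib sum_subtractf sum_distrib_left A_def cell_count_def)
  also have "\<dots> = (\<Sum>i\<in>?I. (snd (D i))\<^sup>2) - A\<^sup>2 / ?N"
    using False by (simp add: m field_simps power2_eq_square)
  finally show ?thesis by (simp add: A_def)
qed

text \<open>The between-group sum of squares for two groups of sizes \<open>p\<close>,
  \<open>m\<close> with totals \<open>A\<close>, \<open>B\<close>. An empty group has total 0, and
  then both sides vanish.\<close>

lemma two_sample_identity:
  fixes A B p m :: real
  assumes "0 \<le> p" "0 \<le> m" "p = 0 \<Longrightarrow> A = 0" "m = 0 \<Longrightarrow> B = 0"
  shows "A\<^sup>2 / p + B\<^sup>2 / m - (A + B)\<^sup>2 / (p + m) = p * m / (p + m) * (A / p - B / m)\<^sup>2"
proof (cases "p = 0 \<or> m = 0")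
  case False
  then have "p > 0" "m > 0" "p + m > 0" using assms by auto
  then show ?thesis by (simp add: divide_simps) algebra
qed (use assms in auto)

text \<open>The empty-cell conventions (means and impurities of empty cells are 0) are consistent with
  this identity, so no positivity of the counts is required.\<close>
lemma imp_dec_eq:
  assumes "\<And>i. i < n \<Longrightarrow> fst (D i) \<in> cube d" "k \<in> free_coords d c"
  shows "real (cell_count n D c) * imp_dec n D c k =
    real (cell_count n D (c(k \<mapsto> 1))) * real (cell_count n D (c(k \<mapsto> - 1)))
      / (real (cell_count n D (c(k \<mapsto> 1))) + real (cell_count n D (c(k \<mapsto> - 1))))
    * (mean_resp n D (c(k \<mapsto> 1)) - mean_resp n D (c(k \<mapsto> - 1)))\<^sup>2"
proof -
  define p m A B where "p = real (cell_count n D (c(k \<mapsto> 1)))" and "m = real (cell_count n D (c(k \<mapsto> - 1)))"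
    and "A = (\<Sum>i\<in>cell_idx n D (c(k \<mapsto> 1)). snd (D i))"
    and "B = (\<Sum>i\<in>cell_idx n D (c(k \<mapsto> - 1)). snd (D i))"
  note sp = cell_idx_split[OF assms]
  have N: "real (cell_count n D c) = p + m"
    by (simp add: p_def m_def cell_count_def sp card_Un_disjoint)
  have sums: "(\<Sum>i\<in>cell_idx n D c. g i)
      = (\<Sum>i\<in>cell_idx n D (c(k \<mapsto> 1)). g i) + (\<Sum>i\<in>cell_idx n D (c(k \<mapsto> - 1)). g i)" for g :: "nat \<Rightarrow> real"
    using sp by (simp only: sum.union_disjoint finite_cell_idx)
  have z: "A = 0" if "p = 0" using that by (auto simp: p_def A_def cell_count_def)
  have z': "B = 0" if "m = 0" using that by (auto simp: m_def B_def cell_count_def)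
  have nn: "0 \<le> p" "0 \<le> m" by (simp_all add: p_def m_def)
  \<comment> \<open>Multiplying by the parent count clears the two weights in
    \<open>imp_dec\<close>; for an empty parent every term is 0.\<close>
  have imp: "(p + m) * imp_dec n D c k
      = (p + m) * impurity n D c - p * impurity n D (c(k \<mapsto> 1)) - m * impurity n D (c(k \<mapsto> - 1))"
  proof (cases "p + m = 0")
    case True
    then have "p = 0" "m = 0" using nn by auto
    then show ?thesis by simp
  next
    case False
    then have "(p + m) * (a / (p + m) * b) = a * b" for a b by simp
    then show ?thesis
      unfolding imp_dec_def N p_def[symmetric] m_def[symmetric] by (simp only: right_diff_distrib)
  qed
  also have "\<dots> = A\<^sup>2 / p + B\<^sup>2 / m - (A + B)\<^sup>2 / (p + m)"
    using count_times_impurity[of n D c] count_times_impurity[of n D "c(k \<mapsto> 1)"]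
      count_times_impurity[of n D "c(k \<mapsto> - 1)"]
    unfolding N p_def[symmetric] m_def[symmetric] sums A_def[symmetric] B_def[symmetric]
    by linarith
  also have "\<dots> = p * m / (p + m) * (A / p - B / m)\<^sup>2"
    by (rule two_sample_identity[OF nn z z'])
  finally show ?thesis
    unfolding N mean_resp_def p_def[symmetric] m_def[symmetric] A_def[symmetric] B_def[symmetric] .
qed

text \<open>A signed square root of count times impurity decrease, taken after centring each child
  mean at its population value. The sign matters: given the labels, this is linear in the responses.
  When the two population values agree, its square is exactly the count times
  \<open>imp_dec\<close>.\<close>

definition split_dev ::
  "nat \<Rightarrow> nat \<Rightarrow> ((nat \<Rightarrow> real) \<Rightarrow> real) \<Rightarrow> (nat \<Rightarrow> (nat \<Rightarrow> real) \<times> real) \<Rightarrow> (nat \<rightharpoonup> real) \<Rightarrow> nat \<Rightarrow> real" where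
  "split_dev d n g D c k =
    sqrt (real (cell_count n D (c(k \<mapsto> 1))) * real (cell_count n D (c(k \<mapsto> - 1)))
      / (real (cell_count n D (c(k \<mapsto> 1))) + real (cell_count n D (c(k \<mapsto> - 1)))))
    * ((mean_resp n D (c(k \<mapsto> 1)) - cond_exp d (c(k \<mapsto> 1)) g)
       - (mean_resp n D (c(k \<mapsto> - 1)) - cond_exp d (c(k \<mapsto> - 1)) g))"

text \<open>\<open>x * y / (x + y)\<close> is half the harmonic mean, hence at least half of the
  smaller entry.\<close>

lemma harmonic_sum_ge:
  fixes x y m :: real
  assumes "0 < m" "m \<le> x" "m \<le> y"
  shows "m / 2 \<le> x * y / (x + y)"
proof -
  have "m * x \<le> y * x" "m * y \<le> x * y"
    using assms by (auto intro: mult_right_mono)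
  then have "m * (x + y) \<le> 2 * (x * y)" by (simp add: algebra_simps)
  then show ?thesis using assms by (simp add: field_simps)
qed

locale cart_model =
  fixes d s n :: nat and f0 :: "(nat \<Rightarrow> real) \<Rightarrow> real" and S :: "nat set"
    and N :: "real measure" and \<sigma> lam \<delta> :: real
  assumes setting: "model_setting d s n f0 S N \<sigma> lam"
    and delta: "0 < \<delta>" "\<delta> \<le> 1"
    and n_large: "real n > 8 * tau d s (supnorm d (fstar_of f0 S s)) \<sigma> \<delta> / lam"
begin

definition f where "f = fstar_of f0 S s"
definition B where "B = supnorm d f"
definition \<tau> where "\<tau> = tau d s B \<sigma> \<delta>"
text \<open>\<open>Lt\<close> pays for pairs of a cell and a split coordinate, hence the
  \<open>d\<close>; \<open>L\<close> pays for cells only. The powers of 3 beyond 3^s leave the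
  factors 1/9 and 1/3 of \<open>\<delta>\<close> in the union bounds.\<close>

definition Lt where "Lt = (real s + 2) * ln 3 + ln (2 * real d / \<delta>)"
definition L where "L = (real s + 1) * ln 3 + ln (2 / \<delta>)"
text \<open>For a cell of probability p, \<open>\<rho> / p\<close> is 2 * (B^2 + \<sigma>^2) * L
  divided by the expected count n * p. This is the squared size of an average noise that is exceeded
  with probability about exp(-L).\<close>

definition \<rho> where "\<rho> = 2 * (B\<^sup>2 + \<sigma>\<^sup>2) * L / real n"

text \<open>SMSP bounds \<open>lam\<close> in terms of the sup norm on every non-constant cell, so every child of a
  non-constant cell satisfies the numerical condition below.\<close>
definition reachable :: "(nat \<rightharpoonup> real) \<Rightarrow> bool" where
  "reachable c \<longleftrightarrow> c \<in> relevant_cells S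
     \<and> (c = Map.empty \<or> 4 * \<tau> \<le> real n * (B\<^sup>2 * (1 / 2) ^ card (dom c)))"

text \<open>The first clause excludes covariates off the cube, which the sample space contains as a
  null set. The count clause is restricted to splits with a large population gap, since only there
  is the expected count known to be large. The strict inequality in the last clause also makes
  reachable cells nonempty.\<close>

definition good :: "(nat \<Rightarrow> (nat \<Rightarrow> real) \<times> real) \<Rightarrow> bool" where
  "good \<omega> \<longleftrightarrow> (\<forall>i<n. fst (\<omega> i) \<in> cube d)
     \<and> (\<forall>c\<in>relevant_cells S. \<forall>k\<in>free_coords d c. \<bar>split_dev d n f (dataset f \<omega>) c k\<bar> < sqrt \<tau>)
     \<and> (\<forall>c\<in>relevant_cells S. \<forall>k\<in>free_coords d c. \<forall>z\<in>{-1, 1}.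
          lam \<le> (cond_cov d c f k)\<^sup>2 * (1 / 2) ^ card (dom c) \<longrightarrow>
          real n * (1 / 2) ^ card (dom c) / 4 < real (cell_count n (dataset f \<omega>) (c(k \<mapsto> z))))
     \<and> (\<forall>c. reachable c \<longrightarrow> \<bar>\<Sum>i\<in>cell_idx n (dataset f \<omega>) c. snd (\<omega> i)\<bar>
          < sqrt (\<rho> * 2 ^ card (dom c)) * real (cell_count n (dataset f \<omega>) c))"

lemma pos: "0 < d" "0 < s" "0 < n" "0 < lam"
  and S: "S \<subseteq> {..<d}" "finite S" "card S = s"
  and noise: "subgaussian_noise N \<sigma>"
  and smsp: "SMSP d S f lam"
  using setting finite_subset[of S "{..<d}"] by (auto simp: model_setting_def f_def)

lemma f_cong: "(\<And>j. j \<in> S \<Longrightarrow> x j = y j) \<Longrightarrow> f x = f y"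
  unfolding f_def using S by (intro fstar_of_cong) auto

lemma f_le: "x \<in> cube d \<Longrightarrow> \<bar>f x\<bar> \<le> B"
  unfolding B_def by (rule abs_le_supnorm)

lemma B_nonneg: "0 \<le> B"
  unfolding B_def by (rule supnorm_nonneg)

lemma L_pos: "1 \<le> L" and Lt_ge: "L \<le> Lt"
proof -
  have "1 \<le> ln (3::real)"
    using ln3_gt_1 by simp
  moreover have "0 \<le> ln (2 / \<delta>)" using delta by (intro ln_ge_zero) (simp add: field_simps)
  moreover have "0 \<le> real s * ln 3" by simp
  ultimately show "1 \<le> L" unfolding L_def ring_distribs by linarith
  have "ln (2 / \<delta>) \<le> ln (2 * real d / \<delta>)"
    using delta pos by (intro ln_mono) (auto simp: field_simps)
  then have "ln 3 + L \<le> Lt" unfolding L_def Lt_def ring_distribs by linarith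
  with \<open>1 \<le> ln 3\<close> show "L \<le> Lt" by linarith
qed

lemma tau_eq: "\<tau> = 18 * (9 * B\<^sup>2 + \<sigma>\<^sup>2) * Lt"
  by (simp add: \<tau>_def tau_def Lt_def)

lemma tau_nonneg: "0 \<le> \<tau>"
  unfolding tau_eq using L_pos Lt_ge by (intro mult_nonneg_nonneg) auto

lemma n_lam: "8 * \<tau> < real n * lam"
  using n_large pos by (simp add: \<tau>_def B_def f_def field_simps)

text \<open>A relevant cell fixes coordinates of \<open>S\<close> only, so the SMSP weight is the
  probability of the cell. This lets \<open>lam\<close> be compared with count-weighted squared
  gaps.\<close>

lemma nonconst_cov:
  assumes c: "c \<in> relevant_cells S" and nc: "\<not> (\<exists>a. \<forall>x\<in>cell_set d c. f x = a)"
  obtains k where "k \<in> free_coords d c" "lam \<le> (cond_cov d c f k)\<^sup>2 * (1 / 2) ^ card (dom c)"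
proof -
  have v: "valid_cell d c" using valid_relevant_cell[OF c S(1)] .
  \<comment> \<open>Needed before the maximum in SMSP can be attained. With no free coordinate all
    of \<open>S\<close> is fixed, and \<open>f\<close> would be constant.\<close>
  have ne: "free_coords d c \<noteq> {}"
  proof
    assume e: "free_coords d c = {}"
    have "f x = f y" if "x \<in> cell_set d c" "y \<in> cell_set d c" for x y
    proof (rule f_cong)
      fix j assume "j \<in> S"
      then have "j \<in> dom c" using e S(1) by (auto simp: free_coords_def)
      then show "x j = y j" using that by (auto simp: cell_set_def)
    qed
    then show False using nc by metis
  qed
  let ?h = "\<lambda>k. (cond_cov d c f k)\<^sup>2 * 2 powr (- real (card (dom c \<inter> S)))"
  have "lam \<le> Max (?h ` free_coords d c)"
    using smsp v nc unfolding SMSP_def by blast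
  moreover have "Max (?h ` free_coords d c) \<in> ?h ` free_coords d c"
    using ne by (intro Max_in) auto
  ultimately obtain k where k: "k \<in> free_coords d c" "lam \<le> ?h k" by auto
  have "dom c \<inter> S = dom c" using c by (auto simp: relevant_cells_def)
  then have "2 powr (- real (card (dom c \<inter> S))) = (1 / 2) ^ card (dom c)"
    by (simp add: powr_minus powr_realpow power_one_over field_simps)
  with k that show ?thesis by auto
qed

text \<open>This is how the sample-size assumption becomes a lower bound on the expected count:
  \<open>\<tau>\<close> contains \<open>162 * B^2 * Lt\<close>, so a factor \<open>B^2\<close> can
  later be cancelled.\<close>

lemma lam_le_sup:
  assumes c: "c \<in> relevant_cells S" and k: "k \<in> free_coords d c"
    and lam: "lam \<le> (cond_cov d c f k)\<^sup>2 * (1 / 2) ^ card (dom c)"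
  shows "8 * \<tau> < real n * (B\<^sup>2 * (1 / 2) ^ card (dom c))"
proof -
  have "\<bar>cond_cov d c f k\<bar> \<le> B"
    using valid_relevant_cell[OF c S(1)] k f_le by (rule cond_cov_abs_le)
  then have "(cond_cov d c f k)\<^sup>2 \<le> B\<^sup>2"
    using B_nonneg by (metis abs_le_square_iff abs_of_nonneg)
  then have "(cond_cov d c f k)\<^sup>2 * (1 / 2) ^ card (dom c) \<le> B\<^sup>2 * (1 / 2) ^ card (dom c)"
    by (intro mult_right_mono) auto
  from order.trans[OF lam this] have "real n * lam \<le> real n * (B\<^sup>2 * (1 / 2) ^ card (dom c))"
    by (rule mult_left_mono) simp
  with n_lam show ?thesis by linarith
qed

section \<open>Deterministic analysis of the tree on the good event\<close>

context
  fixes \<gamma> :: real and \<omega> :: "nat \<Rightarrow> (nat \<Rightarrow> real) \<times> real"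
  assumes gam: "\<tau> / real n \<le> \<gamma>" "\<gamma> < (max 0 (sqrt (lam / 2) - sqrt (\<tau> / real n)))\<^sup>2"
    and good: "good \<omega>"
begin

abbreviation (input) "D \<equiv> dataset f \<omega>"

lemma D_cube: "i < n \<Longrightarrow> fst (D i) \<in> cube d"
  using good by (simp add: good_def dataset_def)

lemma gap: "0 < sqrt (lam / 2) - sqrt (\<tau> / real n)" "\<gamma> < (sqrt (lam / 2) - sqrt (\<tau> / real n))\<^sup>2"
proof -
  \<comment> \<open>Since \<open>\<gamma>\<close> is nonnegative, the strict upper bound can only
    hold if the positive part is positive.\<close>
  have "0 \<le> \<gamma>" using gam(1) tau_nonneg pos by (meson divide_nonneg_nonneg of_nat_0_le_iff order.trans)
  show pos: "0 < sqrt (lam / 2) - sqrt (\<tau> / real n)"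
  proof (rule ccontr)
    assume "\<not> ?thesis"
    then have "max 0 (sqrt (lam / 2) - sqrt (\<tau> / real n)) = 0" by (simp only: max_def) auto
    with gam(2) \<open>0 \<le> \<gamma>\<close> show False by (simp only:) simp
  qed
  then show "\<gamma> < (sqrt (lam / 2) - sqrt (\<tau> / real n))\<^sup>2" using gam(2) by (simp add: max_def)
qed

text \<open>If \<open>f\<close> varied on the leaf, the informative coordinate would have signal
  \<open>\<kappa> * \<Delta>\<close> of absolute value at least \<open>sqrt (n * lam / 2)\<close>
  with an error below \<open>sqrt \<tau>\<close>. Its impurity decrease would then exceed the
  threshold.\<close>

lemma const_of_leaf:
  assumes c: "c \<in> relevant_cells S" and leaf: "is_leaf d n \<gamma> D c"
  shows "\<exists>a. \<forall>x\<in>cell_set d c. f x = a"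
proof (rule ccontr)
  assume nc: "\<not> ?thesis"
  obtain k where k: "k \<in> free_coords d c" "lam \<le> (cond_cov d c f k)\<^sup>2 * (1 / 2) ^ card (dom c)"
    using nonconst_cov[OF c nc] .
  have v: "valid_cell d c" using valid_relevant_cell[OF c S(1)] .
  define p where "p = real (cell_count n D (c(k \<mapsto> 1)))"
  define m where "m = real (cell_count n D (c(k \<mapsto> - 1)))"
  define \<kappa> where "\<kappa> = sqrt (p * m / (p + m))"
  define \<Delta> where "\<Delta> = cond_exp d (c(k \<mapsto> 1)) f - cond_exp d (c(k \<mapsto> - 1)) f"
  define e where "e = mean_resp n D (c(k \<mapsto> 1)) - mean_resp n D (c(k \<mapsto> - 1))"
  define q where "q = real n * (1 / 2) ^ card (dom c)"
  have q0: "0 < q" using pos by (simp add: q_def)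
  have big: "q / 4 < p" "q / 4 < m"
    using good k c by (auto simp: good_def p_def m_def q_def)
  have N: "real (cell_count n D c) = p + m"
    using cell_idx_split[OF D_cube k(1)]
    by (simp add: p_def m_def cell_count_def card_Un_disjoint)
  have \<kappa>2: "\<kappa>\<^sup>2 = p * m / (p + m)"
    using big q0 by (simp add: \<kappa>_def)
  \<comment> \<open>Counts above q/4 give \<kappa>^2 \<ge> q/8, and \<Delta> is twice the
    covariance, so \<kappa>^2 * \<Delta>^2 is at least q/2 times the squared covariance, hence at
    least n * lam / 2. This is the origin of \<open>sqrt (lam / 2)\<close> in the range of
    \<open>\<gamma>\<close>.\<close>
  have "(q / 4) / 2 \<le> p * m / (p + m)"
    using big q0 by (intro harmonic_sum_ge) auto
  then have "q / 8 * \<Delta>\<^sup>2 \<le> \<kappa>\<^sup>2 * \<Delta>\<^sup>2"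
    unfolding \<kappa>2 by (intro mult_right_mono) auto
  moreover have "\<Delta>\<^sup>2 = 4 * (cond_cov d c f k)\<^sup>2"
    unfolding cond_cov_eq[OF v k(1)] \<Delta>_def by (simp add: power_divide)
  moreover have "real n * lam \<le> real n * ((cond_cov d c f k)\<^sup>2 * (1 / 2) ^ card (dom c))"
    using k(2) by (intro mult_left_mono) auto
  moreover have "real n * ((cond_cov d c f k)\<^sup>2 * (1 / 2) ^ card (dom c)) = q * (cond_cov d c f k)\<^sup>2"
    by (simp add: q_def)
  moreover have "(\<kappa> * \<Delta>)\<^sup>2 = \<kappa>\<^sup>2 * \<Delta>\<^sup>2"
    by (rule power_mult_distrib)
  ultimately have "real n * (lam / 2) \<le> (\<kappa> * \<Delta>)\<^sup>2"
    by simp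
  from real_sqrt_le_mono[OF this] have "sqrt (real n * (lam / 2)) \<le> \<bar>\<kappa> * \<Delta>\<bar>"
    by (simp only: real_sqrt_abs)
  moreover have "\<bar>\<kappa> * e - \<kappa> * \<Delta>\<bar> < sqrt \<tau>"
  proof -
    have "split_dev d n f D c k = \<kappa> * e - \<kappa> * \<Delta>"
      unfolding split_dev_def \<kappa>_def p_def m_def e_def \<Delta>_def by (simp only: algebra_simps)
    moreover have "\<bar>split_dev d n f D c k\<bar> < sqrt \<tau>" using good c k(1) by (simp add: good_def)
    ultimately show ?thesis by simp
  qed
  ultimately have "sqrt (real n * (lam / 2)) - sqrt \<tau> < \<bar>\<kappa> * e\<bar>" by linarith
  moreover have "sqrt (real n * (lam / 2)) - sqrt \<tau> = sqrt (real n) * (sqrt (lam / 2) - sqrt (\<tau> / real n))"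
    using pos by (simp add: real_sqrt_mult real_sqrt_divide right_diff_distrib)
  ultimately have "(sqrt (real n) * (sqrt (lam / 2) - sqrt (\<tau> / real n)))\<^sup>2 < \<bar>\<kappa> * e\<bar>\<^sup>2"
    using gap(1) by (intro power_strict_mono) auto
  then have "real n * (sqrt (lam / 2) - sqrt (\<tau> / real n))\<^sup>2 < \<kappa>\<^sup>2 * e\<^sup>2"
    by (simp add: power_mult_distrib)
  moreover have "real n * \<gamma> < real n * (sqrt (lam / 2) - sqrt (\<tau> / real n))\<^sup>2"
    using gap(2) pos by simp
  ultimately have "real n * \<gamma> < \<kappa>\<^sup>2 * e\<^sup>2" by linarith
  also have "\<kappa>\<^sup>2 * e\<^sup>2 = (p + m) * imp_dec n D c k"
    using imp_dec_eq[where n=n and D=D, OF D_cube k(1)] unfolding N p_def[symmetric] m_def[symmetric] e_def[symmetric] \<kappa>2 by simp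
  also have "\<dots> \<le> (p + m) * max_dec d n D c"
    unfolding max_dec_def using k(1) big q0 by (intro mult_left_mono Max_ge) auto
  finally have "\<gamma> < (p + m) / real n * max_dec d n D c"
    using pos by (simp add: field_simps)
  moreover have "free_coords d c \<noteq> {}" using k(1) by auto
  ultimately show False using leaf unfolding is_leaf_def N by simp
qed

text \<open>A split has count times decrease at least n * \<gamma> \<ge> \<tau>. With equal
  population means of the children this quantity would be the square of \<open>split_dev\<close>,
  which is below \<open>\<tau>\<close>. Unequal means in turn exclude both an irrelevant coordinate
  and a constant \<open>f\<close>.\<close>

lemma split_is_relevant:
  assumes c: "c \<in> relevant_cells S" and leaf: "\<not> is_leaf d n \<gamma> D c"
  shows "split_coord d n D c \<in> free_coords d c" "split_coord d n D c \<in> S"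
    "\<not> (\<exists>a. \<forall>x\<in>cell_set d c. f x = a)"
proof -
  define k where "k = split_coord d n D c"
  have v: "valid_cell d c" using valid_relevant_cell[OF c S(1)] .
  have ne: "free_coords d c \<noteq> {}" and ge: "\<gamma> \<le> real (cell_count n D c) / real n * max_dec d n D c"
    using leaf by (auto simp: is_leaf_def)
  have "max_dec d n D c \<in> imp_dec n D c ` free_coords d c"
    unfolding max_dec_def using ne by (intro Max_in) auto
  then obtain k' where "k' \<in> free_coords d c \<and> imp_dec n D c k' = max_dec d n D c" by auto
  then have k: "k \<in> free_coords d c \<and> imp_dec n D c k = max_dec d n D c"
    unfolding k_def split_coord_def by (rule LeastI)
  then show "split_coord d n D c \<in> free_coords d c" by (simp add: k_def)
  have "real n * (\<tau> / real n) \<le> real n * (real (cell_count n D c) / real n * max_dec d n D c)"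
    using gam(1) ge by (intro mult_left_mono) auto
  then have "\<tau> \<le> real (cell_count n D c) * imp_dec n D c k"
    using k pos by simp
  moreover have "real (cell_count n D c) * imp_dec n D c k = (split_dev d n f D c k)\<^sup>2"
    if "cond_exp d (c(k \<mapsto> 1)) f = cond_exp d (c(k \<mapsto> - 1)) f"
    using that imp_dec_eq[where n=n and D=D, OF D_cube conjunct1[OF k]] by (simp add: split_dev_def power_mult_distrib)
  moreover have "(split_dev d n f D c k)\<^sup>2 < \<tau>"
  proof -
    have "\<bar>split_dev d n f D c k\<bar> < sqrt \<tau>" using good c k by (simp add: good_def)
    then have "\<bar>split_dev d n f D c k\<bar>\<^sup>2 < (sqrt \<tau>)\<^sup>2" by (intro power_strict_mono) auto
    then show ?thesis using tau_nonneg by simp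
  qed
  ultimately have ne: "cond_exp d (c(k \<mapsto> 1)) f \<noteq> cond_exp d (c(k \<mapsto> - 1)) f" by linarith
  have "k \<in> S"
  proof (rule ccontr)
    assume "k \<notin> S"
    then have "f (x(k := z)) = f x" for x z by (intro f_cong) auto
    then show False using ne cond_exp_irrelevant[OF v, of k f] k by blast
  qed
  then show "split_coord d n D c \<in> S" by (simp add: k_def)
  show "\<not> (\<exists>a. \<forall>x\<in>cell_set d c. f x = a)"
  proof
    assume "\<exists>a. \<forall>x\<in>cell_set d c. f x = a"
    then obtain a where a: "\<And>x. x \<in> cell_set d c \<Longrightarrow> f x = a" by auto
    have "cond_exp d (c(k \<mapsto> z)) f = a" if "z = 1 \<or> z = - 1" for z
      using k that v a cell_set_upd[of k d c z]
      by (intro cond_exp_const valid_cell_upd) (auto simp: free_coords_def)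
    then show False using ne by metis
  qed
qed

text \<open>The constant value of \<open>f\<close> cancels, leaving the average noise of the leaf. A
  relevant cell fixes at most \<open>s\<close> coordinates, which gives the factor 2^s.\<close>

lemma leaf_error:
  assumes c: "reachable c" and const: "\<exists>a. \<forall>x\<in>cell_set d c. f x = a" and x: "x \<in> cell_set d c"
  shows "(mean_resp n D c - f x)\<^sup>2 \<le> \<rho> * 2 ^ s"
proof -
  let ?I = "cell_idx n D c" and ?N = "real (cell_count n D c)"
  have crel: "c \<in> relevant_cells S" using c by (simp add: reachable_def)
  have lt: "\<bar>\<Sum>i\<in>?I. snd (\<omega> i)\<bar> < sqrt (\<rho> * 2 ^ card (dom c)) * ?N"
    using good c by (simp add: good_def)
  \<comment> \<open>An empty leaf would turn the strict inequality into 0 < 0.\<close>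
  then have N: "0 < ?N" by (cases "?N = 0") auto
  have fi: "f (fst (\<omega> i)) = f x" if "i \<in> ?I" for i
  proof -
    have "fst (\<omega> i) \<in> cell_set d c"
      using that D_cube[of i] by (auto simp: cell_idx_def cell_set_def dataset_def)
    then show ?thesis using const x by metis
  qed
  have "(\<Sum>i\<in>?I. snd (D i)) = (\<Sum>i\<in>?I. f x + snd (\<omega> i))"
    by (intro sum.cong) (auto simp: dataset_def fi)
  also have "\<dots> = ?N * f x + (\<Sum>i\<in>?I. snd (\<omega> i))"
    by (simp add: sum.distrib cell_count_def)
  finally have "mean_resp n D c - f x = (\<Sum>i\<in>?I. snd (\<omega> i)) / ?N"
    using N by (simp add: mean_resp_def field_simps)
  then have "\<bar>mean_resp n D c - f x\<bar> \<le> sqrt (\<rho> * 2 ^ card (dom c))"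
    using lt N by (simp only: abs_divide) (simp add: field_simps)
  then have "\<bar>mean_resp n D c - f x\<bar>\<^sup>2 \<le> (sqrt (\<rho> * 2 ^ card (dom c)))\<^sup>2"
    by (intro power_mono) auto
  moreover have \<rho>: "0 \<le> \<rho>"
    using L_pos by (auto simp: \<rho>_def intro!: divide_nonneg_nonneg mult_nonneg_nonneg)
  moreover have "\<rho> * 2 ^ card (dom c) \<le> \<rho> * 2 ^ s"
  proof -
    have "card (dom c) \<le> s"
      using crel S card_mono[of S "dom c"] by (auto simp: relevant_cells_def)
    then show ?thesis using \<rho> by (intro mult_left_mono power_increasing) auto
  qed
  ultimately show ?thesis by simp
qed

text \<open>The invariant bounds the number of free coordinates by the fuel. When the fuel runs out
  there is nothing left to split, so that case is a genuine leaf.\<close>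

lemma cart_eval_error:
  assumes "reachable c" "x \<in> cell_set d c" "card (free_coords d c) \<le> m"
  shows "(cart_eval m d n \<gamma> D c x - f x)\<^sup>2 \<le> \<rho> * 2 ^ s"
  using assms
proof (induction m arbitrary: c)
  case 0
  then have "is_leaf d n \<gamma> D c" by (simp add: is_leaf_def)
  then show ?case
    using 0 const_of_leaf leaf_error by (simp add: reachable_def)
next
  case (Suc m)
  have c: "c \<in> relevant_cells S" using Suc.prems by (simp add: reachable_def)
  show ?case
  proof (cases "is_leaf d n \<gamma> D c")
    case True
    then show ?thesis using Suc.prems const_of_leaf[OF c] leaf_error by simp
  next
    case False
    define k where "k = split_coord d n D c"
    have k: "k \<in> free_coords d c" "k \<in> S" "\<not> (\<exists>a. \<forall>x\<in>cell_set d c. f x = a)"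
      using split_is_relevant[OF c False] by (simp_all add: k_def)
    obtain j where j: "j \<in> free_coords d c" "lam \<le> (cond_cov d c f j)\<^sup>2 * (1 / 2) ^ card (dom c)"
      using nonconst_cov[OF c k(3)] .
    have v: "valid_cell d c" using valid_relevant_cell[OF c S(1)] .
    have xk: "x k = 1 \<or> x k = - 1"
      using Suc.prems(2) k(1) cube_coord[of x d k] by (simp add: cell_set_def free_coords_def)
    \<comment> \<open>The bound holds at the parent; halving the cell probability turns 8 into the 4
      required by \<open>reachable\<close>.\<close>
    have "8 * \<tau> < real n * (B\<^sup>2 * (1 / 2) ^ card (dom c))"
      by (rule lam_le_sup[OF c j])
    then have "4 * \<tau> \<le> real n * (B\<^sup>2 * (1 / 2) ^ card (dom (c(k \<mapsto> x k))))"
      unfolding card_dom_upd[OF v k(1)] by simp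
    then have "reachable (c(k \<mapsto> x k))"
      using relevant_cells_upd[OF c k(2) xk] by (simp add: reachable_def)
    moreover have "x \<in> cell_set d (c(k \<mapsto> x k))"
      using Suc.prems(2) by (simp add: cell_set_upd[OF k(1)])
    moreover have "card (free_coords d (c(k \<mapsto> x k))) \<le> m"
    proof -
      have "free_coords d (c(k \<mapsto> x k)) = free_coords d c - {k}" by (auto simp: free_coords_def)
      then show ?thesis using Suc.prems(3) k(1) by simp
    qed
    ultimately have "(cart_eval m d n \<gamma> D (c(k \<mapsto> x k)) x - f x)\<^sup>2 \<le> \<rho> * 2 ^ s"
      by (rule Suc.IH)
    then show ?thesis using False by (simp add: k_def Let_def)
  qed
qed

lemma cart_error: "x \<in> cube d \<Longrightarrow> (cart d n \<gamma> D x - f x)\<^sup>2 \<le> \<rho> * 2 ^ s"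
  unfolding cart_def
  by (rule cart_eval_error)
     (auto simp: reachable_def empty_relevant_cell cell_set_def free_coords_def)

end

end

section \<open>Measurability and single-observation integrals\<close>

definition obs_space :: "nat \<Rightarrow> real measure \<Rightarrow> ((nat \<Rightarrow> real) \<times> real) measure" where
  "obs_space d N = measure_pmf (pmf_of_set (cube d)) \<Otimes>\<^sub>M N"

lemma sample_space_eq: "sample_space d n N = PiM {..<n} (\<lambda>_. obs_space d N)"
  by (simp add: sample_space_def obs_space_def)

text \<open>The first factor is discrete with all sets measurable, so every function of the
  covariates is measurable.\<close>

lemma measurable_fst_obs: "g \<circ> fst \<in> obs_space d N \<rightarrow>\<^sub>M count_space UNIV"
proof -
  have "fst \<in> obs_space d N \<rightarrow>\<^sub>M count_space UNIV"
    unfolding obs_space_def by measurable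
  then show ?thesis by (rule measurable_comp) simp
qed

lemma measurable_fst_obs_real:
  fixes g :: "(nat \<Rightarrow> real) \<Rightarrow> real"
  shows "(\<lambda>z. g (fst z)) \<in> borel_measurable (obs_space d N)"
proof -
  have "fst \<in> obs_space d N \<rightarrow>\<^sub>M count_space UNIV"
    unfolding obs_space_def by measurable
  then show ?thesis by (rule measurable_compose) simp
qed

lemma measurable_fst_obs_pred: "Measurable.pred (obs_space d N) (\<lambda>z. P (fst z))"
  using measurable_fst_obs[of P d N] by (simp add: comp_def)

lemma measurable_snd_obs:
  assumes "sets N = sets borel"
  shows "snd \<in> borel_measurable (obs_space d N)"
proof -
  have "snd \<in> obs_space d N \<rightarrow>\<^sub>M N" unfolding obs_space_def by measurable
  then show ?thesis using measurable_cong_sets[OF refl assms] by blast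
qed

context
  fixes d n :: nat and N :: "real measure" and g :: "(nat \<Rightarrow> real) \<Rightarrow> real"
  assumes N: "sets N = sets borel"
begin

abbreviation (input) "\<Omega> \<equiv> sample_space d n N"

lemma measurable_comp_obs:
  assumes "h \<in> obs_space d N \<rightarrow>\<^sub>M K" "i < n"
  shows "(\<lambda>\<omega>. h (\<omega> i)) \<in> \<Omega> \<rightarrow>\<^sub>M K"
  unfolding sample_space_eq
  by (rule measurable_compose[OF measurable_component_singleton[of i "{..<n}" "\<lambda>_. obs_space d N"] assms(1)])
     (use assms(2) in simp)

lemma measurable_eps: "i < n \<Longrightarrow> (\<lambda>\<omega>. snd (\<omega> i)) \<in> borel_measurable \<Omega>"
  by (rule measurable_comp_obs[OF measurable_snd_obs[OF N]])

lemma measurable_resp: "i < n \<Longrightarrow> (\<lambda>\<omega>. snd (dataset g \<omega> i)) \<in> borel_measurable \<Omega>"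
  unfolding dataset_def snd_conv
  by (intro borel_measurable_add measurable_eps
      measurable_comp_obs[OF measurable_fst_obs_real[of g]])

lemma pred_cell_idx:
  assumes "i < n"
  shows "Measurable.pred \<Omega> (\<lambda>\<omega>. i \<in> cell_idx n (dataset g \<omega>) c)"
proof -
  have "(\<lambda>\<omega>. (\<lambda>z. \<forall>j\<in>dom c. fst z j = the (c j)) (\<omega> i)) \<in> \<Omega> \<rightarrow>\<^sub>M count_space UNIV"
    by (rule measurable_comp_obs[OF measurable_fst_obs_pred assms])
  then show ?thesis
    using assms by (simp only: cell_idx_def dataset_def mem_Collect_eq fst_conv simp_thms)
qed

lemma measurable_cell_sum:
  fixes h :: "nat \<Rightarrow> _ \<Rightarrow> real"
  assumes h: "\<And>i. i < n \<Longrightarrow> h i \<in> borel_measurable \<Omega>"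
  shows "(\<lambda>\<omega>. \<Sum>i\<in>cell_idx n (dataset g \<omega>) c. h i \<omega>) \<in> borel_measurable \<Omega>"
proof -
  \<comment> \<open>The index set is random; indicators move the randomness into the summands over a
    fixed range.\<close>
  have "(\<Sum>i\<in>cell_idx n (dataset g \<omega>) c. h i \<omega>)
      = (\<Sum>i<n. if i \<in> cell_idx n (dataset g \<omega>) c then h i \<omega> else 0)" for \<omega>
    by (rule sum.mono_neutral_cong_left) (auto simp: cell_idx_def)
  moreover have "(\<lambda>\<omega>. \<Sum>i<n. if i \<in> cell_idx n (dataset g \<omega>) c then h i \<omega> else 0) \<in> borel_measurable \<Omega>"
    by (intro borel_measurable_sum measurable_If h pred_cell_idx[unfolded pred_def]) auto
  ultimately show ?thesis by (simp only:)
qed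

lemma measurable_cell_count:
  "(\<lambda>\<omega>. real (cell_count n (dataset g \<omega>) c)) \<in> borel_measurable \<Omega>"
  using measurable_cell_sum[of "\<lambda>_ _. 1" c]
  by (simp only: cell_count_def sum_constant mult_1_right borel_measurable_const)

lemma measurable_mean_resp:
  "(\<lambda>\<omega>. mean_resp n (dataset g \<omega>) c) \<in> borel_measurable \<Omega>"
  unfolding mean_resp_def
  by (intro borel_measurable_divide measurable_cell_sum measurable_resp measurable_cell_count)

lemma measurable_impurity:
  "(\<lambda>\<omega>. impurity n (dataset g \<omega>) c) \<in> borel_measurable \<Omega>"
  unfolding impurity_def
  by (intro borel_measurable_divide measurable_cell_sum measurable_resp measurable_cell_count
      borel_measurable_power borel_measurable_diff measurable_mean_resp)

lemma measurable_imp_dec: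
  "(\<lambda>\<omega>. imp_dec n (dataset g \<omega>) c k) \<in> borel_measurable \<Omega>"
  unfolding imp_dec_def
  by (intro borel_measurable_diff borel_measurable_times borel_measurable_divide
      measurable_impurity measurable_cell_count)

lemma measurable_max_dec:
  "(\<lambda>\<omega>. max_dec d n (dataset g \<omega>) c) \<in> borel_measurable \<Omega>"
  unfolding max_dec_def
  by (rule borel_measurable_Max[where f="\<lambda>k \<omega>. imp_dec n (dataset g \<omega>) c k"])
     (simp_all only: finite_free_coords measurable_imp_dec)

lemma measurable_is_leaf: "Measurable.pred \<Omega> (\<lambda>\<omega>. is_leaf d n \<gamma> (dataset g \<omega>) c)"
proof -
  have "Measurable.pred \<Omega> (\<lambda>\<omega>. real (cell_count n (dataset g \<omega>) c) / real n * max_dec d n (dataset g \<omega>) c < \<gamma>)"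
    unfolding pred_def
    by (intro borel_measurable_less borel_measurable_times borel_measurable_divide
        measurable_cell_count measurable_max_dec borel_measurable_const)
  then show ?thesis
    unfolding is_leaf_def by (intro pred_intros_logic) auto
qed

lemma measurable_split_coord:
  "(\<lambda>\<omega>. split_coord d n (dataset g \<omega>) c) \<in> \<Omega> \<rightarrow>\<^sub>M count_space UNIV"
proof -
  have "Measurable.pred \<Omega> (\<lambda>\<omega>. imp_dec n (dataset g \<omega>) c k = max_dec d n (dataset g \<omega>) c)" for k
    unfolding pred_def by (intro borel_measurable_eq measurable_imp_dec measurable_max_dec)
  then show ?thesis
    unfolding split_coord_def by (intro measurable_Least pred_intros_logic) auto
qed

lemma measurable_split_dev:
  "(\<lambda>\<omega>. split_dev d n u (dataset g \<omega>) c k) \<in> borel_measurable \<Omega>"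
  unfolding split_dev_def
  by (intro borel_measurable_times borel_measurable_diff borel_measurable_const borel_measurable_divide
      borel_measurable_add measurable_compose[OF _ borel_measurable_sqrt] measurable_cell_count measurable_mean_resp)

text \<open>The split coordinate depends on the sample but has countably many values, so the
  recursive call is a countable gluing of measurable functions.\<close>

lemma measurable_cart_eval:
  "(\<lambda>\<omega>. cart_eval m d n \<gamma> (dataset g \<omega>) c x) \<in> borel_measurable \<Omega>"
proof (induction m arbitrary: c)
  case (Suc m)
  have "(\<lambda>\<omega>. cart_eval m d n \<gamma> (dataset g \<omega>) (c(split_coord d n (dataset g \<omega>) c \<mapsto>
       x (split_coord d n (dataset g \<omega>) c))) x) \<in> borel_measurable \<Omega>"
    by (rule measurable_compose_countable[where
          f="\<lambda>k \<omega>. cart_eval m d n \<gamma> (dataset g \<omega>) (c(k \<mapsto> x k)) x",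
          OF Suc.IH measurable_split_coord])
  then show ?case
    unfolding cart_eval.simps Let_def
    by (intro measurable_If measurable_mean_resp measurable_is_leaf[unfolded pred_def])
qed (simp add: measurable_mean_resp)

lemma measurable_risk_cart:
  "(\<lambda>\<omega>. risk d (cart d n \<gamma> (dataset g \<omega>)) u) \<in> borel_measurable \<Omega>"
proof -
  have c: "(\<lambda>\<omega>. cart d n \<gamma> (dataset g \<omega>) x) \<in> borel_measurable \<Omega>" for x
    unfolding cart_def by (rule measurable_cart_eval)
  show ?thesis
    unfolding risk_def integral_pmf_of_set[OF cube_nonempty finite_cube]
    by (intro borel_measurable_divide borel_measurable_sum borel_measurable_power borel_measurable_diff
        borel_measurable_const c)
qed

end

lemma prob_space_obs: "prob_space N \<Longrightarrow> prob_space (obs_space d N)"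
  unfolding obs_space_def
  by (intro prob_space_pair measure_pmf.prob_space_axioms)

text \<open>Tonelli plus counting on the cube. All single-observation exponential moments are
  reduced to integrands of this product form.\<close>

lemma nn_integral_obs:
  assumes N: "prob_space N" "sets N = sets borel"
    and u: "\<And>x. x \<in> cube d \<Longrightarrow> 0 \<le> u x" and w: "w \<in> borel_measurable borel"
  shows "(\<integral>\<^sup>+z. ennreal (u (fst z)) * w (snd z) \<partial>obs_space d N)
    = ennreal ((\<Sum>x\<in>cube d. u x) / 2 ^ d) * (\<integral>\<^sup>+e. w e \<partial>N)"
proof -
  interpret N: prob_space N by fact
  let ?P = "measure_pmf (pmf_of_set (cube d))"
  have w': "w \<in> borel_measurable N" using w N(2) by (simp cong: measurable_cong_sets)
  have "(\<lambda>z. ennreal (u (fst z)) * w (snd z)) \<in> borel_measurable (?P \<Otimes>\<^sub>M N)"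
    by (intro borel_measurable_times_ennreal measurable_compose[OF measurable_snd w']
        measurable_compose[OF measurable_fst, of "\<lambda>x. ennreal (u x)"]) simp
  then have "(\<integral>\<^sup>+z. ennreal (u (fst z)) * w (snd z) \<partial>obs_space d N)
      = (\<integral>\<^sup>+x. \<integral>\<^sup>+e. ennreal (u x) * w e \<partial>N \<partial>?P)"
    unfolding obs_space_def by (subst N.nn_integral_fst[symmetric]) simp_all
  also have "\<dots> = (\<integral>\<^sup>+x. ennreal (u x) * (\<integral>\<^sup>+e. w e \<partial>N) \<partial>?P)"
    by (simp add: nn_integral_cmult w')
  also have "\<dots> = (\<integral>\<^sup>+x. ennreal (u x) \<partial>?P) * (\<integral>\<^sup>+e. w e \<partial>N)"
    by (rule nn_integral_multc) simp
  also have "(\<integral>\<^sup>+x. ennreal (u x) \<partial>?P) = (\<Sum>x\<in>cube d. ennreal (u x)) / of_nat (2 ^ d)"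
    by (subst nn_integral_pmf_of_set) (auto simp: card_cube)
  also have "\<dots> = ennreal ((\<Sum>x\<in>cube d. u x) / 2 ^ d)"
    using u by (simp add: sum_nonneg divide_ennreal[symmetric] ennreal_of_nat_eq_real_of_nat ennreal_power[symmetric])
  finally show ?thesis .
qed

lemma subgaussian_nn_integral:
  assumes "subgaussian_noise N \<sigma>"
  shows "(\<integral>\<^sup>+e. ennreal (exp (t * e)) \<partial>N) \<le> ennreal (exp (\<sigma>\<^sup>2 * t\<^sup>2 / 2))"
proof -
  have "(\<integral>\<^sup>+e. ennreal (exp (t * e)) \<partial>N) = ennreal (\<integral>e. exp (t * e) \<partial>N)"
    using assms by (intro nn_integral_eq_integral) (auto simp: subgaussian_noise_def)
  then show ?thesis using assms by (simp add: subgaussian_noise_def ennreal_leI)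
qed

text \<open>Hoeffding's lemma for the uniform law on the cell: the range has length 2 * B, and (2 *
  B)^2 / 8 = B^2 / 2.\<close>

lemma hoeffding_cell:
  assumes c: "valid_cell d c" and B: "\<And>x. x \<in> cube d \<Longrightarrow> \<bar>g x\<bar> \<le> B"
  shows "(\<Sum>x\<in>cell_set d c. exp (a * (g x - cond_exp d c g)))
    \<le> real (card (cell_set d c)) * exp (a\<^sup>2 * B\<^sup>2 / 2)"
proof -
  let ?C = "cell_set d c" and ?\<mu> = "cond_exp d c g"
  let ?p = "pmf_of_set ?C"
  have ne: "?C \<noteq> {}" by (rule cell_set_nonempty[OF c])
  then have card: "0 < real (card ?C)" by (simp add: card_gt_0_iff)
  \<comment> \<open>Hoeffding's lemma takes a positive parameter; \<open>r = - 1\<close> covers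
    negative \<open>a\<close> by reflection.\<close>
  have pos: "(\<Sum>x\<in>?C. exp (l * (r * (g x - ?\<mu>)))) \<le> real (card ?C) * exp (l\<^sup>2 * B\<^sup>2 / 2)"
    if l: "0 < l" and r: "r = 1 \<or> r = - 1" for l r
  proof -
    define h where "h = (\<lambda>x. r * (g x - ?\<mu>))"
    interpret interval_bounded_random_variable "measure_pmf ?p" h "- B - r * ?\<mu>" "B - r * ?\<mu>"
    proof
      show "AE x in measure_pmf ?p. h x \<in> {- B - r * ?\<mu>..B - r * ?\<mu>}"
      proof (subst AE_measure_pmf_iff, intro ballI)
        fix x assume "x \<in> set_pmf ?p"
        then have "\<bar>g x\<bar> \<le> B" using B cell_set_subset ne by (auto simp: set_pmf_of_set)
        then show "h x \<in> {- B - r * ?\<mu>..B - r * ?\<mu>}"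
          using r by (auto simp: h_def algebra_simps)
      qed
    qed simp
    have "integral\<^sup>L (measure_pmf ?p) h = (\<Sum>x\<in>?C. h x) / card ?C"
      by (rule integral_pmf_of_set[OF ne finite_cell_set])
    also have "(\<Sum>x\<in>?C. h x) = r * ((\<Sum>x\<in>?C. g x) - card ?C * ?\<mu>)"
      by (simp add: h_def sum_distrib_left[symmetric] sum_subtractf)
    also have "\<dots> = 0" using card by (simp add: cond_exp_def)
    finally have "integral\<^sup>L (measure_pmf ?p) h = 0" by simp
    from Hoeffdings_lemma_nn_integral_0[OF l this]
    have "(\<integral>\<^sup>+x. ennreal (exp (l * h x)) \<partial>measure_pmf ?p) \<le> ennreal (exp (l\<^sup>2 * B\<^sup>2 / 2))"
      by (simp add: power_mult_distrib mult.commute)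
    also have "(\<integral>\<^sup>+x. ennreal (exp (l * h x)) \<partial>measure_pmf ?p)
        = ennreal ((\<Sum>x\<in>?C. exp (l * h x)) / card ?C)"
      using ne card by (subst nn_integral_pmf_of_set)
        (auto simp: sum_nonneg divide_ennreal[symmetric] ennreal_of_nat_eq_real_of_nat)
    finally show ?thesis
      using card by (simp add: h_def field_simps)
  qed
  consider "a = 0" | "0 < a" | "a < 0" by linarith
  then show ?thesis
  proof cases
    case 1 then show ?thesis by simp
  next
    case 2 then show ?thesis using pos[of a 1] by simp
  next
    case 3 then show ?thesis using pos[of "- a" "- 1"] by (simp add: right_diff_distrib)
  qed
qed

section \<open>Deviation probabilities\<close>

lemma sum_two_labels:
  fixes l :: "nat \<Rightarrow> real" and u w :: "nat \<Rightarrow> real"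
  shows "(\<Sum>i<n. if l i = 1 then u i else if l i = - 1 then w i else 0)
    = (\<Sum>i\<in>{i\<in>{..<n}. l i = 1}. u i) + (\<Sum>i\<in>{i\<in>{..<n}. l i = - 1}. w i)"
proof -
  have "(\<Sum>i<n. if l i = 1 then u i else if l i = - 1 then w i else 0)
      = (\<Sum>i<n. (if l i = 1 then u i else 0) + (if l i = - 1 then w i else 0))"
    by (intro sum.cong) auto
  then show ?thesis
    unfolding sum.distrib by (simp only: sum.inter_filter[OF finite_lessThan])
qed

lemma sum_cell_idx:
  fixes u :: "nat \<Rightarrow> real"
  shows "(\<Sum>i\<in>cell_idx n (dataset g \<omega>) c. u i)
    = (\<Sum>i<n. if \<forall>j\<in>dom c. fst (\<omega> i) j = the (c j) then u i else 0)"
proof -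
  have "cell_idx n (dataset g \<omega>) c = {i\<in>{..<n}. \<forall>j\<in>dom c. fst (\<omega> i) j = the (c j)}"
    by (auto simp: cell_idx_def dataset_def)
  then show ?thesis by (simp only: sum.inter_filter[OF finite_lessThan])
qed

text \<open>The left side is the mean of a factor equal to \<open>y\<close> with probability
  \<open>p\<close> and to 1 otherwise, as occurs for membership in a cell.\<close>

lemma exp_sub_mean_bound:
  fixes p y :: real
  shows "1 - p + p * y \<le> exp (- (p * (1 - y)))"
  using exp_ge_add_one_self[of "- (p * (1 - y))"] by (simp add: algebra_simps)

section \<open>Chernoff bounds for cell counts and noise sums\<close>

context cart_model
begin

lemma N_prob: "prob_space N" and N_sets: "sets N = sets borel"
  using noise by (auto simp: subgaussian_noise_def)

abbreviation (input) "Q \<equiv> obs_space d N"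
abbreviation (input) "Om \<equiv> sample_space d n N"

lemma Q_prob: "prob_space Q"
  by (rule prob_space_obs[OF N_prob])

lemma Om_prob: "prob_space Om"
  unfolding sample_space_eq by (intro prob_space_PiM Q_prob)

lemma measurable_exp_scale: "(\<lambda>e::real. ennreal (exp (a * e))) \<in> borel_measurable borel"
  by measurable

lemma sum_cube_matching:
  fixes u :: "(nat \<Rightarrow> real) \<Rightarrow> real"
  shows "(\<Sum>x\<in>cube d. if \<forall>j\<in>dom c. x j = the (c j) then u x else 0) = (\<Sum>x\<in>cell_set d c. u x)"
  unfolding cell_set_def by (rule sum.inter_filter[symmetric]) simp

lemma cell_mgf:
  assumes c: "valid_cell d c"
  shows "(\<integral>\<^sup>+z. ennreal (exp (q + (if \<forall>j\<in>dom c. fst z j = the (c j) then b + a * snd z else 0))) \<partial>Q)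
    \<le> ennreal (exp q * (1 - (1 / 2) ^ card (dom c) + (1 / 2) ^ card (dom c) * exp (b + \<sigma>\<^sup>2 * a\<^sup>2 / 2)))"
proof -
  let ?m = "\<lambda>x. \<forall>j\<in>dom c. x j = the (c j)"
  define p where "p = (1 / 2 :: real) ^ card (dom c)"
  \<comment> \<open>Splitting the integrand by cell membership makes each piece a product of a
    function of the covariate and one of the noise.\<close>
  define u1 where "u1 = (\<lambda>x. if ?m x then exp (q + b) else 0)"
  define u2 where "u2 = (\<lambda>x. if ?m x then 0 else exp q)"
  have nn: "0 \<le> u1 x" "0 \<le> u2 x" for x by (auto simp: u1_def u2_def)
  have i1: "(\<integral>\<^sup>+z. ennreal (u1 (fst z)) * ennreal (exp (a * snd z)) \<partial>Q)
      = ennreal ((\<Sum>x\<in>cube d. u1 x) / 2 ^ d) * (\<integral>\<^sup>+e. ennreal (exp (a * e)) \<partial>N)"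
    by (rule nn_integral_obs[OF N_prob N_sets nn(1) measurable_exp_scale])
  have i2: "(\<integral>\<^sup>+z. ennreal (u2 (fst z)) * 1 \<partial>Q)
      = ennreal ((\<Sum>x\<in>cube d. u2 x) / 2 ^ d) * (\<integral>\<^sup>+e. 1 \<partial>N)"
    by (rule nn_integral_obs[OF N_prob N_sets nn(2) borel_measurable_const])
  have p: "0 \<le> p" "p \<le> 1" by (auto simp: p_def intro: power_le_one)
  have u1: "(\<Sum>x\<in>cube d. u1 x) / 2 ^ d = p * exp (q + b)"
    unfolding u1_def sum_cube_matching using card_cell_set[OF c] by (simp add: p_def)
  have "(\<Sum>x\<in>cube d. u2 x) = (\<Sum>x\<in>cube d. exp q - (if ?m x then exp q else 0))"
    by (intro sum.cong) (auto simp: u2_def)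
  also have "\<dots> = 2 ^ d * exp q - card (cell_set d c) * exp q"
    unfolding sum_subtractf sum_cube_matching by (simp add: card_cube)
  finally have u2: "(\<Sum>x\<in>cube d. u2 x) / 2 ^ d = (1 - p) * exp q"
    using card_cell_set[OF c] by (simp add: p_def diff_divide_distrib left_diff_distrib)
  have "(\<integral>\<^sup>+z. ennreal (exp (q + (if ?m (fst z) then b + a * snd z else 0))) \<partial>Q)
      = (\<integral>\<^sup>+z. ennreal (u1 (fst z)) * ennreal (exp (a * snd z)) + ennreal (u2 (fst z)) * 1 \<partial>Q)"
    by (intro nn_integral_cong) (auto simp: u1_def u2_def ennreal_mult'[symmetric] exp_add[symmetric] add.assoc)
  also have "\<dots> = (\<integral>\<^sup>+z. ennreal (u1 (fst z)) * ennreal (exp (a * snd z)) \<partial>Q)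
      + (\<integral>\<^sup>+z. ennreal (u2 (fst z)) * 1 \<partial>Q)"
    by (intro nn_integral_add borel_measurable_times_ennreal measurable_compose[OF _ measurable_ennreal]
        measurable_fst_obs_real measurable_compose[OF measurable_snd_obs[OF N_sets] measurable_exp_scale]
        borel_measurable_const)
  also have "\<dots> = ennreal (p * exp (q + b)) * (\<integral>\<^sup>+e. ennreal (exp (a * e)) \<partial>N)
      + ennreal ((1 - p) * exp q) * (\<integral>\<^sup>+e. 1 \<partial>N)"
    unfolding i1 i2 u1 u2 by (rule refl)
  also have "\<dots> \<le> ennreal (p * exp (q + b)) * ennreal (exp (\<sigma>\<^sup>2 * a\<^sup>2 / 2)) + ennreal ((1 - p) * exp q)"
    using subgaussian_nn_integral[OF noise, of a] prob_space.emeasure_space_1[OF N_prob]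
    by (intro add_mono mult_left_mono) auto
  also have "\<dots> = ennreal (exp q * (1 - p + p * exp (b + \<sigma>\<^sup>2 * a\<^sup>2 / 2)))"
    using p by (simp add: ennreal_mult'[symmetric] ennreal_plus[symmetric] exp_add algebra_simps
        del: ennreal_plus)
  finally show ?thesis unfolding p_def .
qed

text \<open>One score serves two purposes: \<open>a = 0\<close>, \<open>b = - 1\<close> bounds the
  count from below, while \<open>q = 0\<close> compares the noise sum with the random count.\<close>

lemma cell_chernoff:
  assumes c: "valid_cell d c"
  shows "measure Om {\<omega> \<in> space Om. 0 \<le> real n * q + (\<Sum>i\<in>cell_idx n (dataset f \<omega>) c. b + a * snd (\<omega> i))}
    \<le> (exp q * (1 - (1 / 2) ^ card (dom c) + (1 / 2) ^ card (dom c) * exp (b + \<sigma>\<^sup>2 * a\<^sup>2 / 2))) ^ n"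
proof -
  let ?\<phi> = "\<lambda>z. q + (if \<forall>j\<in>dom c. fst z j = the (c j) then b + a * snd z else 0)"
  have "?\<phi> \<in> borel_measurable Q"
    by (intro borel_measurable_add borel_measurable_const measurable_If borel_measurable_times
        measurable_snd_obs[OF N_sets] measurable_fst_obs_pred[unfolded pred_def])
  moreover have "0 \<le> exp q * (1 - (1 / 2) ^ card (dom c) + (1 / 2) ^ card (dom c) * exp (b + \<sigma>\<^sup>2 * a\<^sup>2 / 2))"
    by (intro mult_nonneg_nonneg add_nonneg_nonneg) (auto simp: power_le_one)
  ultimately have "measure Om {\<omega> \<in> space Om. 0 \<le> (\<Sum>i<n. ?\<phi> (\<omega> i))}
      \<le> (exp q * (1 - (1 / 2) ^ card (dom c) + (1 / 2) ^ card (dom c) * exp (b + \<sigma>\<^sup>2 * a\<^sup>2 / 2))) ^ n"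
    unfolding sample_space_eq by (intro iid_chernoff[OF Q_prob _ cell_mgf[OF c]])
  moreover have "(\<Sum>i<n. ?\<phi> (\<omega> i)) = real n * q + (\<Sum>i\<in>cell_idx n (dataset f \<omega>) c. b + a * snd (\<omega> i))" for \<omega>
    unfolding sum_cell_idx by (subst sum.distrib) simp
  ultimately show ?thesis by (simp only:)
qed

text \<open>With Chernoff parameter 1 the exponent per observation is p/2 - p * (1 - 1/e), which is
  at most -p/8 since 1/e \<le> 3/8.\<close>

lemma count_tail:
  assumes c: "valid_cell d c"
  shows "measure Om {\<omega> \<in> space Om.
      real (cell_count n (dataset f \<omega>) c) \<le> real n * (1 / 2) ^ card (dom c) / 2}
    \<le> exp (- (real n * (1 / 2) ^ card (dom c) / 8))"
proof -
  define p where "p = (1 / 2 :: real) ^ card (dom c)"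
  have p: "0 \<le> p" "p \<le> 1" by (auto simp: p_def intro: power_le_one)
  have "measure Om {\<omega> \<in> space Om. real (cell_count n (dataset f \<omega>) c) \<le> real n * p / 2}
      \<le> (exp (p / 2) * (1 - p + p * exp (- 1))) ^ n"
    using cell_chernoff[OF c, of "p / 2" "- 1" 0] by (simp add: cell_count_def p_def)
  also have "\<dots> \<le> (exp (p / 2) * exp (- (p * (1 - exp (- 1))))) ^ n"
    using p by (intro power_mono mult_left_mono exp_sub_mean_bound mult_nonneg_nonneg add_nonneg_nonneg) auto
  also have "\<dots> = exp (real n * (p / 2 - p * (1 - exp (- 1))))"
    unfolding exp_add[symmetric] exp_of_nat_mult[symmetric] by simp
  also have "\<dots> \<le> exp (- (real n * p / 8))"
  proof -
    have "1 + 1 + 1 / 2 + 1 / 6 \<le> exp (1 :: real)"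
      using exp_lower_Taylor_quadratic[of 1] e_approx_32 by (simp add: abs_if split: if_splits)
    then have "exp (- 1 :: real) \<le> 3 / 8" by (simp add: exp_minus field_simps)
    then have "p * exp (- 1) \<le> p * (3 / 8)" by (intro mult_left_mono) (auto simp: p_def)
    then have "p / 2 - p * (1 - exp (- 1)) \<le> - (p / 8)" by (simp add: right_diff_distrib)
    then have "real n * (p / 2 - p * (1 - exp (- 1))) \<le> real n * (- (p / 8))"
      by (rule mult_left_mono) simp
    then show ?thesis by simp
  qed
  finally show ?thesis unfolding p_def .
qed

text \<open>Each observation in the cell scores a * (r * eps - t) and every other one 0, so count
  and noise are integrated together. The proxy \<open>v\<close> is left free above \<sigma>^2 so
  that variance slack can be traded for the loss caused by the random count.\<close>

lemma noise_tail:
  assumes c: "valid_cell d c" and r: "r = 1 \<or> r = - 1" and t: "0 < t" and v: "0 < v" "\<sigma>\<^sup>2 \<le> v"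
  shows "measure Om {\<omega> \<in> space Om. t * real (cell_count n (dataset f \<omega>) c)
      \<le> r * (\<Sum>i\<in>cell_idx n (dataset f \<omega>) c. snd (\<omega> i))}
    \<le> (1 - (1 / 2) ^ card (dom c) + (1 / 2) ^ card (dom c) * exp (- (t\<^sup>2 / (2 * v)))) ^ n"
proof -
  define p where "p = (1 / 2 :: real) ^ card (dom c)"
  \<comment> \<open>Minimises - a * t + v * a^2 / 2.\<close>
  define a where "a = t / v"
  have p: "0 \<le> p" "p \<le> 1" by (auto simp: p_def intro: power_le_one)
  have a: "0 < a" using t v by (simp add: a_def)
  have "0 \<le> real n * 0 + (\<Sum>i\<in>cell_idx n (dataset f \<omega>) c. - (a * t) + a * r * snd (\<omega> i)) \<longleftrightarrow>
      t * real (cell_count n (dataset f \<omega>) c) \<le> r * (\<Sum>i\<in>cell_idx n (dataset f \<omega>) c. snd (\<omega> i))" for \<omega>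
  proof -
    have "real n * 0 + (\<Sum>i\<in>cell_idx n (dataset f \<omega>) c. - (a * t) + a * r * snd (\<omega> i))
        = a * (r * (\<Sum>i\<in>cell_idx n (dataset f \<omega>) c. snd (\<omega> i)) - t * real (cell_count n (dataset f \<omega>) c))"
      unfolding sum.distrib sum_distrib_left[symmetric] by (simp add: cell_count_def algebra_simps)
    then show ?thesis using a by (simp add: zero_le_mult_iff)
  qed
  with cell_chernoff[OF c, of 0 "- (a * t)" "a * r"]
  have "measure Om {\<omega> \<in> space Om. t * real (cell_count n (dataset f \<omega>) c)
      \<le> r * (\<Sum>i\<in>cell_idx n (dataset f \<omega>) c. snd (\<omega> i))}
    \<le> (1 - p + p * exp (- (a * t) + \<sigma>\<^sup>2 * (a * r)\<^sup>2 / 2)) ^ n"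
    by (simp only: p_def exp_zero mult_1_left)
  also have "\<dots> \<le> (1 - p + p * exp (- (t\<^sup>2 / (2 * v)))) ^ n"
  proof -
    have "(a * r)\<^sup>2 = a\<^sup>2" using r by auto
    then have "\<sigma>\<^sup>2 * (a * r)\<^sup>2 / 2 \<le> v * a\<^sup>2 / 2"
      using v by (simp add: mult_right_mono)
    moreover have "- (a * t) + v * a\<^sup>2 / 2 = - (t\<^sup>2 / (2 * v))"
      using v by (simp add: a_def field_simps power2_eq_square)
    ultimately have "exp (- (a * t) + \<sigma>\<^sup>2 * (a * r)\<^sup>2 / 2) \<le> exp (- (t\<^sup>2 / (2 * v)))"
      by simp
    then show ?thesis
      using p by (intro power_mono add_left_mono mult_left_mono add_nonneg_nonneg mult_nonneg_nonneg) auto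
  qed
  finally show ?thesis unfolding p_def .
qed

end

text \<open>The squared norm of the weights is \<kappa>^2 * (1/p + 1/m) = 1 when both children are
  occupied; otherwise \<kappa> and all weights are 0.\<close>

lemma weights_norm_le_1:
  fixes p m :: real
  assumes "0 \<le> p" "0 \<le> m"
  shows "p * (sqrt (p * m / (p + m)) / p)\<^sup>2 + m * (sqrt (p * m / (p + m)) / m)\<^sup>2 \<le> 1"
proof (cases "p = 0 \<or> m = 0")
  case False
  then have pm: "0 < p" "0 < m" using assms by auto
  then have "(sqrt (p * m / (p + m)))\<^sup>2 = p * m / (p + m)" by simp
  then have "p * (sqrt (p * m / (p + m)) / p)\<^sup>2 + m * (sqrt (p * m / (p + m)) / m)\<^sup>2
      = m / (p + m) + p / (p + m)"
    using pm by (simp add: power_divide) (simp add: power2_eq_square)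
  also have "\<dots> = 1" using pm by (simp add: add_divide_distrib[symmetric])
  finally show ?thesis by simp
qed auto

section \<open>Sub-Gaussian tail of the split statistic\<close>

context cart_model
begin

text \<open>Proxy of a centred response within a cell: \<open>B^2\<close> from Hoeffding's lemma for
  \<open>f\<close>, plus \<sigma>^2 for the independent noise.\<close>

definition v0 where "v0 = B\<^sup>2 + \<sigma>\<^sup>2"

lemma centred_cell_mgf:
  assumes c: "valid_cell d c"
  shows "(\<integral>\<^sup>+z. ennreal (exp (a * (f (fst z) + snd z - cond_exp d c f)))
        * indicator {z. fst z \<in> cell_set d c} z \<partial>Q)
    \<le> ennreal (exp (a\<^sup>2 * v0 / 2)) * ennreal ((1 / 2) ^ card (dom c))"
proof -
  define \<mu> where "\<mu> = cond_exp d c f"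
  define u where "u = (\<lambda>x. if x \<in> cell_set d c then exp (a * (f x - \<mu>)) else 0)"
  have nn: "0 \<le> u x" for x by (auto simp: u_def)
  have "(\<integral>\<^sup>+z. ennreal (exp (a * (f (fst z) + snd z - \<mu>))) * indicator {z. fst z \<in> cell_set d c} z \<partial>Q)
      = (\<integral>\<^sup>+z. ennreal (u (fst z)) * ennreal (exp (a * snd z)) \<partial>Q)"
    by (intro nn_integral_cong)
       (auto simp: u_def indicator_def ennreal_mult'[symmetric] exp_add[symmetric] algebra_simps)
  also have "\<dots> = ennreal ((\<Sum>x\<in>cube d. u x) / 2 ^ d) * (\<integral>\<^sup>+e. ennreal (exp (a * e)) \<partial>N)"
    by (rule nn_integral_obs[OF N_prob N_sets nn measurable_exp_scale])
  also have "(\<Sum>x\<in>cube d. u x) = (\<Sum>x\<in>cell_set d c. exp (a * (f x - \<mu>)))"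
    unfolding u_def using cell_set_subset by (intro sum.mono_neutral_cong_right) auto
  also have "ennreal (\<dots> / 2 ^ d) * (\<integral>\<^sup>+e. ennreal (exp (a * e)) \<partial>N)
      \<le> ennreal (real (card (cell_set d c)) * exp (a\<^sup>2 * B\<^sup>2 / 2) / 2 ^ d) * ennreal (exp (\<sigma>\<^sup>2 * a\<^sup>2 / 2))"
    unfolding \<mu>_def using hoeffding_cell[OF c f_le]
    by (intro mult_mono ennreal_leI divide_right_mono subgaussian_nn_integral[OF noise]) auto
  also have "\<dots> = ennreal (exp (a\<^sup>2 * v0 / 2)) * ennreal ((1 / 2) ^ card (dom c))"
    using card_cell_set[OF c]
    by (simp add: ennreal_mult'[symmetric] exp_add[symmetric] v0_def algebra_simps add_divide_distrib)
  finally show ?thesis unfolding \<mu>_def .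
qed

lemma nn_integral_cell_indicator:
  assumes c: "valid_cell d c"
  shows "(\<integral>\<^sup>+z. indicator {z. fst z \<in> cell_set d c} z \<partial>Q) = ennreal ((1 / 2) ^ card (dom c))"
proof -
  define u where "u = (\<lambda>x. if x \<in> cell_set d c then 1 else 0 :: real)"
  have nn: "0 \<le> u x" for x by (auto simp: u_def)
  have "(\<integral>\<^sup>+z. indicator {z. fst z \<in> cell_set d c} z \<partial>Q) = (\<integral>\<^sup>+z. ennreal (u (fst z)) * 1 \<partial>Q)"
    by (intro nn_integral_cong) (auto simp: u_def)
  also have "\<dots> = ennreal ((\<Sum>x\<in>cube d. u x) / 2 ^ d) * (\<integral>\<^sup>+e. 1 \<partial>N)"
    by (rule nn_integral_obs[OF N_prob N_sets nn borel_measurable_const])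
  also have "(\<Sum>x\<in>cube d. u x) = (\<Sum>x\<in>cell_set d c. 1)"
    unfolding u_def using cell_set_subset by (intro sum.mono_neutral_cong_right) auto
  finally show ?thesis
    using card_cell_set[OF c] prob_space.emeasure_space_1[OF N_prob] by simp
qed

text \<open>The underlying space contains all functions as covariates; being on the cube is a
  property of the support only.\<close>

lemma AE_cube: "AE z in Q. fst z \<in> cube d"
proof -
  have s: "{z \<in> space Q. fst z \<notin> cube d} \<in> sets Q"
    using measurable_fst_obs_pred[where d=d and N=N and P="\<lambda>x. x \<notin> cube d"] by (simp only: pred_def)
  have "emeasure Q {z \<in> space Q. fst z \<notin> cube d} = (\<integral>\<^sup>+z. indicator {z \<in> space Q. fst z \<notin> cube d} z \<partial>Q)"
    using s by simp
  also have "\<dots> = (\<integral>\<^sup>+z. ennreal (if fst z \<in> cube d then 0 else 1) * 1 \<partial>Q)"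
    by (intro nn_integral_cong) auto
  also have "\<dots> = ennreal ((\<Sum>x\<in>cube d. if x \<in> cube d then 0 else 1) / 2 ^ d) * (\<integral>\<^sup>+e. 1 \<partial>N)"
    by (rule nn_integral_obs[OF N_prob N_sets _ borel_measurable_const]) auto
  also have "\<dots> = 0" by simp
  finally show ?thesis
    by (intro AE_I[OF _ _ s]) auto
qed

text \<open>Labels 1, -1 and 0 record the child or the outside of the cell. They determine the
  counts, hence the weights, and the centred responses stay sub-Gaussian on each label
  class.\<close>

lemma split_dev_tail:
  assumes c: "valid_cell d c" and k: "k \<in> free_coords d c" and v: "0 < v0"
    and r: "r = 1 \<or> r = - 1" and t: "0 \<le> t"
  shows "measure Om {\<omega> \<in> space Om. t \<le> r * split_dev d n f (dataset f \<omega>) c k} \<le> exp (- t\<^sup>2 / (2 * v0))"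
proof -
  have kd: "k < d" "k \<notin> dom c" using k by (auto simp: free_coords_def)
  \<comment> \<open>Requiring \<open>x k\<close> to be a sign keeps the label set finite off the
    cube too.\<close>
  define labx where "labx = (\<lambda>x. if (\<forall>j\<in>dom c. x j = the (c j)) \<and> (x k = 1 \<or> x k = - 1) then x k else 0 :: real)"
  define lab where "lab = (\<lambda>z :: (nat \<Rightarrow> real) \<times> real. labx (fst z))"
  define \<mu> where "\<mu> = (\<lambda>z. cond_exp d (c(k \<mapsto> z)) f)"
  define h where "h = (\<lambda>z. if lab z = 0 then 0 else f (fst z) + snd z - \<mu> (lab z))"
  define cnt where "cnt = (\<lambda>(l :: nat \<Rightarrow> real) z. real (card {i\<in>{..<n}. l i = z}))"
  define \<kappa> where "\<kappa> = (\<lambda>l. sqrt (cnt l 1 * cnt l (- 1) / (cnt l 1 + cnt l (- 1))))"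
  define W where "W = (\<lambda>l i. if l i = 1 then r * (\<kappa> l / cnt l 1) else if l i = - 1 then - r * (\<kappa> l / cnt l (- 1)) else 0)"
  have r2: "r\<^sup>2 = 1" using r by auto
  have lab_cell: "{z. lab z = l} \<inter> {z. fst z \<in> cube d} = {z. fst z \<in> cell_set d (c(k \<mapsto> l))}"
    if "l = 1 \<or> l = - 1" for l
    using that kd(2) unfolding cell_set_upd[OF k] by (auto simp: lab_def labx_def cell_set_def)
  have labm: "lab \<in> Q \<rightarrow>\<^sub>M count_space UNIV"
    using measurable_fst_obs[of labx d N] by (simp only: lab_def comp_def)
  have hm: "h \<in> borel_measurable Q"
  proof -
    have "(\<lambda>z. if lab z = 0 then 0 else f (fst z) + snd z - \<mu> (lab z)) \<in> borel_measurable Q"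
      unfolding lab_def
      by (intro measurable_If borel_measurable_add borel_measurable_diff borel_measurable_const
          measurable_snd_obs[OF N_sets] measurable_fst_obs_real[of "\<lambda>x. \<mu> (labx x)"]
          measurable_fst_obs_real[of f] measurable_fst_obs_pred[unfolded pred_def])
    then show ?thesis by (simp only: h_def)
  qed
  have mgf: "(\<integral>\<^sup>+z. ennreal (exp (a * h z)) * indicator {z. lab z = l} z \<partial>Q)
      \<le> ennreal (exp (a\<^sup>2 * v0 / 2)) * emeasure Q {z \<in> space Q. lab z = l}" if l: "l \<in> {1, - 1, 0}" for a l
  proof -
    have em: "emeasure Q {z \<in> space Q. lab z = l} = (\<integral>\<^sup>+z. indicator {z. lab z = l} z \<partial>Q)"
    proof -
      have "{z \<in> space Q. lab z = l} \<in> sets Q"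
        using measurable_fst_obs_pred[where d=d and N=N and P="\<lambda>x. labx x = l"] by (simp only: pred_def lab_def)
      then have "emeasure Q {z \<in> space Q. lab z = l} = (\<integral>\<^sup>+z. indicator {z \<in> space Q. lab z = l} z \<partial>Q)"
        by simp
      also have "\<dots> = (\<integral>\<^sup>+z. indicator {z. lab z = l} z \<partial>Q)"
        by (intro nn_integral_cong) (auto simp: indicator_def)
      finally show ?thesis .
    qed
    show ?thesis
    proof (cases "l = 0")
      case True
      have "(\<integral>\<^sup>+z. ennreal (exp (a * h z)) * indicator {z. lab z = l} z \<partial>Q) = 1 * emeasure Q {z \<in> space Q. lab z = l}"
        unfolding em using True by (auto intro!: nn_integral_cong simp: h_def indicator_def)
      also have "\<dots> \<le> ennreal (exp (a\<^sup>2 * v0 / 2)) * emeasure Q {z \<in> space Q. lab z = l}"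
        using v by (intro mult_right_mono) auto
      finally show ?thesis .
    next
      case False
      then have l1: "l = 1 \<or> l = - 1" using l by auto
      have vl: "valid_cell d (c(k \<mapsto> l))" using valid_cell_upd[OF c kd(1) l1] .
      \<comment> \<open>Off the cube a point can carry label 1 or -1 without lying in the child
        cell, so the indicators agree only almost everywhere.\<close>
      have ind: "AE z in Q. indicator {z. lab z = l} z = (indicator {z. fst z \<in> cell_set d (c(k \<mapsto> l))} z :: ennreal)"
        using AE_cube
      proof eventually_elim
        case (elim z)
        then show ?case using lab_cell[OF l1] by (auto simp: indicator_def)
      qed
      have "(\<integral>\<^sup>+z. ennreal (exp (a * h z)) * indicator {z. lab z = l} z \<partial>Q)
          = (\<integral>\<^sup>+z. ennreal (exp (a * (f (fst z) + snd z - \<mu> l))) * indicator {z. lab z = l} z \<partial>Q)"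
        using False by (intro nn_integral_cong) (auto simp: h_def indicator_def)
      also have "\<dots> = (\<integral>\<^sup>+z. ennreal (exp (a * (f (fst z) + snd z - \<mu> l)))
          * indicator {z. fst z \<in> cell_set d (c(k \<mapsto> l))} z \<partial>Q)"
        using ind by (intro nn_integral_cong_AE) auto
      also have "\<dots> \<le> ennreal (exp (a\<^sup>2 * v0 / 2)) * ennreal ((1 / 2) ^ card (dom (c(k \<mapsto> l))))"
        unfolding \<mu>_def by (rule centred_cell_mgf[OF vl])
      also have "ennreal ((1 / 2) ^ card (dom (c(k \<mapsto> l)))) = emeasure Q {z \<in> space Q. lab z = l}"
        unfolding em nn_integral_cell_indicator[OF vl, symmetric] using ind by (intro nn_integral_cong_AE) auto
      finally show ?thesis .
    qed
  qed
  have cnt0: "0 \<le> cnt l z" for l z by (simp add: cnt_def)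
  have W1: "(\<Sum>i<n. (W l i)\<^sup>2) \<le> 1" for l
  proof -
    have "(\<Sum>i<n. (W l i)\<^sup>2) = (\<Sum>i<n. if l i = 1 then (\<kappa> l / cnt l 1)\<^sup>2
        else if l i = - 1 then (\<kappa> l / cnt l (- 1))\<^sup>2 else 0)"
      by (intro sum.cong) (auto simp: W_def power_mult_distrib power_divide r2)
    also have "\<dots> = cnt l 1 * (\<kappa> l / cnt l 1)\<^sup>2 + cnt l (- 1) * (\<kappa> l / cnt l (- 1))\<^sup>2"
      unfolding sum_two_labels by (simp add: cnt_def)
    also have "\<dots> \<le> 1"
      unfolding \<kappa>_def by (rule weights_norm_le_1[OF cnt0 cnt0])
    finally show ?thesis .
  qed
  have ev: "(\<Sum>i<n. W (\<lambda>i\<in>{..<n}. lab (\<omega> i)) i * h (\<omega> i)) = r * split_dev d n f (dataset f \<omega>) c k" for \<omega>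
  proof -
    let ?D = "dataset f \<omega>"
    define l where "l = (\<lambda>i\<in>{..<n}. lab (\<omega> i))"
    have l: "l i = lab (\<omega> i)" if "i < n" for i using that by (simp add: l_def)
    have idx: "{i\<in>{..<n}. l i = z} = cell_idx n ?D (c(k \<mapsto> z))" if "z = 1 \<or> z = - 1" for z
    proof -
      have "l i = z \<longleftrightarrow> (\<forall>j\<in>dom c. fst (\<omega> i) j = the (c j)) \<and> fst (\<omega> i) k = z" if "i < n" for i
        using \<open>z = 1 \<or> z = - 1\<close> that by (auto simp: l lab_def labx_def)
      then show ?thesis
        unfolding cell_idx_upd[OF kd(2)] by (auto simp: cell_idx_def dataset_def)
    qed
    have cnt_l: "cnt l z = real (cell_count n ?D (c(k \<mapsto> z)))" if "z = 1 \<or> z = - 1" for z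
      using idx[OF that] by (simp only: cnt_def cell_count_def)
    have dev: "(\<Sum>i\<in>{i\<in>{..<n}. l i = z}. h (\<omega> i)) = cnt l z * (mean_resp n ?D (c(k \<mapsto> z)) - \<mu> z)"
      if z: "z = 1 \<or> z = - 1" for z
    proof -
      have "(\<Sum>i\<in>{i\<in>{..<n}. l i = z}. h (\<omega> i)) = (\<Sum>i\<in>{i\<in>{..<n}. l i = z}. snd (?D i) - \<mu> z)"
        using z by (intro sum.cong) (auto simp: h_def l dataset_def)
      also have "\<dots> = (\<Sum>i\<in>cell_idx n ?D (c(k \<mapsto> z)). snd (?D i)) - cnt l z * \<mu> z"
        unfolding sum_subtractf idx[OF z] cnt_l[OF z] by (simp add: cell_count_def)
      also have "(\<Sum>i\<in>cell_idx n ?D (c(k \<mapsto> z)). snd (?D i)) = cnt l z * mean_resp n ?D (c(k \<mapsto> z))"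
      proof (cases "cell_count n ?D (c(k \<mapsto> z)) = 0")
        case True
        then have "cell_idx n ?D (c(k \<mapsto> z)) = {}" by (simp add: cell_count_def)
        then show ?thesis using True by (simp add: cnt_l[OF z])
      next
        case False
        then show ?thesis by (simp add: cnt_l[OF z] mean_resp_def)
      qed
      finally show ?thesis by (simp only: right_diff_distrib)
    qed
    \<comment> \<open>For an empty child the count does not cancel, but then
      \<open>\<kappa> l\<close> is 0.\<close>
    have k0: "\<kappa> l / cnt l z * (cnt l z * y) = \<kappa> l * y" if z: "z = 1 \<or> z = - 1" for z y
      using z by (cases "cnt l z = 0") (auto simp: \<kappa>_def)
    have "(\<Sum>i<n. W l i * h (\<omega> i)) = (\<Sum>i<n. if l i = 1 then r * (\<kappa> l / cnt l 1) * h (\<omega> i)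
        else if l i = - 1 then - r * (\<kappa> l / cnt l (- 1)) * h (\<omega> i) else 0)"
      by (intro sum.cong) (auto simp: W_def)
    also have "\<dots> = r * (\<kappa> l / cnt l 1) * (\<Sum>i\<in>{i\<in>{..<n}. l i = 1}. h (\<omega> i))
        + (- r * (\<kappa> l / cnt l (- 1))) * (\<Sum>i\<in>{i\<in>{..<n}. l i = - 1}. h (\<omega> i))"
      unfolding sum_two_labels sum_distrib_left ..
    also have "\<dots> = r * (\<kappa> l / cnt l 1 * (cnt l 1 * (mean_resp n ?D (c(k \<mapsto> 1)) - \<mu> 1)))
        - r * (\<kappa> l / cnt l (- 1) * (cnt l (- 1) * (mean_resp n ?D (c(k \<mapsto> - 1)) - \<mu> (- 1))))"
      using dev[of 1] dev[of "- 1"] by (simp only: simp_thms mult.assoc mult_minus_left diff_conv_add_uminus)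
    also have "\<dots> = r * (\<kappa> l * (mean_resp n ?D (c(k \<mapsto> 1)) - \<mu> 1))
        - r * (\<kappa> l * (mean_resp n ?D (c(k \<mapsto> - 1)) - \<mu> (- 1)))"
      using k0[of 1] k0[of "- 1"] by (simp only: simp_thms)
    also have "\<dots> = r * split_dev d n f ?D c k"
      unfolding split_dev_def \<kappa>_def \<mu>_def using cnt_l[of 1] cnt_l[of "- 1"]
      by (simp only: simp_thms right_diff_distrib)
    finally show ?thesis by (simp only: l_def)
  qed
  have "measure (PiM {..<n} (\<lambda>_. Q)) {\<omega> \<in> space (PiM {..<n} (\<lambda>_. Q)).
     t \<le> (\<Sum>i<n. W (\<lambda>i\<in>{..<n}. lab (\<omega> i)) i * h (\<omega> i))} \<le> exp (- t\<^sup>2 / (2 * v0))"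
    by (rule labelled_subgaussian_tail[where Lab="{1, - 1, 0}", OF Q_prob hm labm _ _ v t mgf W1])
       (auto simp: lab_def labx_def)
  then show ?thesis
    by (simp only: ev sample_space_eq)
qed

end

lemma abs_less_iff_not_le: "\<bar>x\<bar> < (y::real) \<longleftrightarrow> \<not> (\<exists>r\<in>{1, - 1}. y \<le> r * x)"
  by auto

lemma (in prob_space) prob_UN_le:
  assumes "finite I" "\<And>i. i \<in> I \<Longrightarrow> E i \<in> events" "\<And>i. i \<in> I \<Longrightarrow> prob (E i) \<le> e"
  shows "prob (\<Union>i\<in>I. E i) \<le> real (card I) * e"
proof -
  have "prob (\<Union>i\<in>I. E i) \<le> (\<Sum>i\<in>I. prob (E i))"
    using assms by (intro finite_measure_subadditive_finite) auto
  also have "\<dots> \<le> real (card I) * e"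
    using assms by (intro sum_bounded_above) auto
  finally show ?thesis .
qed

section \<open>Union bound for the good event\<close>

context cart_model
begin

text \<open>The prefactors bound the number of events: two signs, 3^s cells and, for
  \<open>Lt\<close>, \<open>d\<close> coordinates.\<close>

lemma exp_Lt: "2 * 3 ^ s * real d * exp (- Lt) = \<delta> / 9"
  and exp_L: "2 * 3 ^ s * exp (- L) = \<delta> / 3"
proof -
  have e3: "exp (real m * ln 3) = (3::real) ^ m" for m
    by (simp add: exp_of_nat_mult)
  have "exp Lt = exp (real (s + 2) * ln 3) * exp (ln (2 * real d / \<delta>))"
    by (simp add: Lt_def exp_add[symmetric])
  also have "\<dots> = 3 ^ (s + 2) * (2 * real d / \<delta>)"
    unfolding e3 using delta pos by simp
  finally show "2 * 3 ^ s * real d * exp (- Lt) = \<delta> / 9"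
    using delta pos by (simp add: exp_minus field_simps)
  have "exp L = exp (real (s + 1) * ln 3) * exp (ln (2 / \<delta>))"
    by (simp add: L_def exp_add[symmetric])
  also have "\<dots> = 3 ^ (s + 1) * (2 / \<delta>)"
    unfolding e3 using delta by simp
  finally show "2 * 3 ^ s * exp (- L) = \<delta> / 3"
    using delta by (simp add: exp_minus field_simps)
qed

lemma tau_ge: "18 * v0 * Lt \<le> \<tau>" "162 * B\<^sup>2 * Lt + 18 * \<sigma>\<^sup>2 * Lt = \<tau>"
proof -
  show "162 * B\<^sup>2 * Lt + 18 * \<sigma>\<^sup>2 * Lt = \<tau>" by (simp add: tau_eq algebra_simps)
  have "0 \<le> B\<^sup>2 * Lt" using L_pos Lt_ge by (intro mult_nonneg_nonneg) auto
  then show "18 * v0 * Lt \<le> \<tau>" by (simp add: tau_eq v0_def algebra_simps)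
qed

lemma split_event_prob:
  assumes c: "c \<in> relevant_cells S" and k: "k \<in> free_coords d c" and v: "0 < v0"
    and r: "r = 1 \<or> r = - 1"
  shows "measure Om {\<omega> \<in> space Om. sqrt \<tau> \<le> r * split_dev d n f (dataset f \<omega>) c k} \<le> exp (- Lt)"
proof -
  have "2 * v0 * Lt \<le> 18 * v0 * Lt" using v L_pos Lt_ge by (intro mult_right_mono) auto
  then have "2 * v0 * Lt \<le> \<tau>" using tau_ge(1) by linarith
  then have "Lt \<le> \<tau> / (2 * v0)" using v by (simp add: field_simps)
  then have "exp (- (sqrt \<tau>)\<^sup>2 / (2 * v0)) \<le> exp (- Lt)" using tau_nonneg by simp
  moreover have "0 \<le> sqrt \<tau>" using tau_nonneg by simp
  ultimately show ?thesis
    using split_dev_tail[OF valid_relevant_cell[OF c S(1)] k v r] order.trans by blast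
qed

lemma count_event_prob:
  assumes c: "c \<in> relevant_cells S" and k: "k \<in> free_coords d c"
    and z: "z = 1 \<or> z = - 1" and lam: "lam \<le> (cond_cov d c f k)\<^sup>2 * (1 / 2) ^ card (dom c)"
  shows "measure Om {\<omega> \<in> space Om. real (cell_count n (dataset f \<omega>) (c(k \<mapsto> z)))
      \<le> real n * (1 / 2) ^ card (dom c) / 4} \<le> exp (- Lt)"
proof -
  define p where "p = (1 / 2 :: real) ^ card (dom c)"
  have v: "valid_cell d c" by (rule valid_relevant_cell[OF c S(1)])
  have vk: "valid_cell d (c(k \<mapsto> z))" using valid_cell_upd[OF v _ z] k by (simp add: free_coords_def)
  have p': "(1 / 2 :: real) ^ card (dom (c(k \<mapsto> z))) = p / 2"
    unfolding card_dom_upd[OF v k] p_def by simp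
  have "8 * \<tau> < real n * (B\<^sup>2 * p)"
    unfolding p_def by (rule lam_le_sup[OF c k lam])
  moreover have "0 \<le> \<sigma>\<^sup>2 * Lt" using L_pos Lt_ge by (intro mult_nonneg_nonneg) auto
  \<comment> \<open>The \<sigma>^2 part of \<open>\<tau>\<close> is dropped and 8 * 162 = 1296.
    After cancelling B^2, the exponent n * p / 16 of the child count exceeds
    \<open>Lt\<close>.\<close>
  ultimately have "B\<^sup>2 * (1296 * Lt) < B\<^sup>2 * (real n * p)"
    using tau_ge(2) by (simp add: algebra_simps)
  then have "1296 * Lt < real n * p"
    by (rule mult_left_less_imp_less) simp
  then have "exp (- (real n * (p / 2) / 8)) \<le> exp (- Lt)"
    using L_pos Lt_ge by simp
  moreover have "real n * (p / 2) / 2 = real n * p / 4" by simp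
  ultimately show ?thesis
    using count_tail[OF vk] unfolding p' p_def[symmetric] by (simp only:)
qed

text \<open>With u the exponent of \<open>noise_tail\<close>, the aim is p * (1 - exp(-u)) \<ge>
  L/n, that is 1 - exp(-u) \<ge> x. Taking u = x would just fail, so u = x + 2 * x^2 is obtained
  from a smaller proxy \<open>w\<close>.\<close>

lemma noise_event_prob:
  assumes c: "reachable c" and v: "0 < v0" and r: "r = 1 \<or> r = - 1"
  shows "measure Om {\<omega> \<in> space Om. sqrt (\<rho> * 2 ^ card (dom c)) * real (cell_count n (dataset f \<omega>) c)
      \<le> r * (\<Sum>i\<in>cell_idx n (dataset f \<omega>) c. snd (\<omega> i))} \<le> exp (- L)"
proof -
  have vc: "valid_cell d c"
    using valid_relevant_cell[OF _ S(1)] c by (simp add: reachable_def)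
  define p where "p = (1 / 2 :: real) ^ card (dom c)"
  define t where "t = sqrt (\<rho> * 2 ^ card (dom c))"
  have p: "0 < p" "p \<le> 1" by (auto simp: p_def power_le_one)
  have \<rho>: "\<rho> = 2 * v0 * L / real n" by (simp add: \<rho>_def v0_def)
  have \<rho>0: "0 < \<rho>" using v L_pos pos by (simp add: \<rho>)
  then have t: "0 < t" by (simp add: t_def)
  define x where "x = L / (real n * p)"
  have x0: "0 \<le> x" using L_pos p by (simp add: x_def)
  have t2: "t\<^sup>2 = 2 * v0 * x"
  proof -
    have "t\<^sup>2 = \<rho> * 2 ^ card (dom c)" using \<rho>0 by (simp add: t_def)
    then show ?thesis by (simp add: \<rho> x_def p_def power_one_over)
  qed
  show ?thesis
  proof (cases "c = Map.empty")
    \<comment> \<open>At the root every observation counts, p = 1, and the factor exp(-x) itself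
      suffices without any loss to repair.\<close>
    case True
    then have p1: "p = 1" by (simp add: p_def)
    have "t\<^sup>2 / (2 * v0) = L / real n" using v by (simp add: t2 x_def p1)
    moreover have "\<sigma>\<^sup>2 \<le> v0" by (simp add: v0_def)
    moreover have "exp (- (L / real n)) ^ n = exp (- L)"
      unfolding exp_of_nat_mult[symmetric] using pos by simp
    ultimately show ?thesis
      using noise_tail[OF vc r t v] unfolding p_def[symmetric] t_def[symmetric] p1 by simp
  next
    case False
    then have "4 * \<tau> \<le> real n * (B\<^sup>2 * p)" using c by (simp add: reachable_def p_def)
    moreover have "B\<^sup>2 * L \<le> B\<^sup>2 * Lt" "\<sigma>\<^sup>2 * L \<le> \<sigma>\<^sup>2 * Lt"
      using Lt_ge by (auto intro: mult_left_mono)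
    ultimately have big: "648 * (B\<^sup>2 * L) + 72 * (\<sigma>\<^sup>2 * L) \<le> B\<^sup>2 * (real n * p)"
      using tau_ge(2) by (simp add: algebra_simps)
    have nn: "0 \<le> B\<^sup>2 * L" "0 \<le> \<sigma>\<^sup>2 * L" using L_pos by auto
    \<comment> \<open>If \<open>B\<close> were 0, reachability would force \<sigma>^2 = 0 as well,
      against \<open>0 < v0\<close>.\<close>
    have B2: "0 < B\<^sup>2"
    proof (rule ccontr)
      assume "\<not> 0 < B\<^sup>2"
      then have "B\<^sup>2 = 0" using zero_le_power2[of B] by linarith
      moreover then have "72 * (\<sigma>\<^sup>2 * L) \<le> 0" using big by simp
      ultimately have "\<sigma>\<^sup>2 = 0" using L_pos by (simp add: mult_le_0_iff)
      with \<open>B\<^sup>2 = 0\<close> v show False by (simp add: v0_def)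
    qed
    have np: "0 < real n * p" using pos p by simp
    have "B\<^sup>2 * (648 * L) \<le> B\<^sup>2 * (real n * p)" using big nn by (simp add: mult.left_commute)
    then have "648 * L \<le> real n * p" using B2 by (simp add: mult_le_cancel_left)
    then have x2: "x \<le> 1 / 2" using np L_pos by (simp add: x_def field_simps)
    \<comment> \<open>This is what makes the smaller proxy admissible: \<sigma>^2 \<le> v0 / (1 + 2
      * x) is equivalent to 2 * x * \<sigma>^2 \<le> B^2.\<close>
    have "2 * (\<sigma>\<^sup>2 * L) \<le> B\<^sup>2 * (real n * p)" using big nn by linarith
    then have "2 * x * \<sigma>\<^sup>2 \<le> B\<^sup>2" using np by (simp add: x_def field_simps)
    \<comment> \<open>The factor \<open>1 + 2 * x\<close> compensates for \<open>1 - exp (- u)\<close> being smaller than \<open>u\<close>.\<close>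
    define w where "w = v0 / (1 + 2 * x)"
    have w: "0 < w" "\<sigma>\<^sup>2 \<le> w"
      using v x0 \<open>2 * x * \<sigma>\<^sup>2 \<le> B\<^sup>2\<close> by (auto simp: w_def v0_def field_simps)
    have "t\<^sup>2 / (2 * w) = x + 2 * x\<^sup>2"
      unfolding t2 using v x0 by (simp add: w_def field_simps power2_eq_square)
    moreover have "exp (- (x + 2 * x\<^sup>2)) \<le> 1 - x"
    proof -
      have "- (x + 2 * x\<^sup>2) \<le> ln (1 - x)"
        using ln_one_minus_pos_lower_bound[OF x0 x2] by simp
      then have "exp (- (x + 2 * x\<^sup>2)) \<le> exp (ln (1 - x))" by simp
      then show ?thesis using x2 by simp
    qed
    ultimately have "p * x \<le> p * (1 - exp (- (t\<^sup>2 / (2 * w))))"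
      using p by (intro mult_left_mono) auto
    moreover have "p * x = L / real n" using p by (simp add: x_def)
    ultimately have "1 - p + p * exp (- (t\<^sup>2 / (2 * w))) \<le> exp (- (L / real n))"
      using exp_sub_mean_bound[of p "exp (- (t\<^sup>2 / (2 * w)))"] by (smt (verit) exp_le_cancel_iff)
    then have "(1 - p + p * exp (- (t\<^sup>2 / (2 * w)))) ^ n \<le> exp (- (L / real n)) ^ n"
      using p by (intro power_mono add_nonneg_nonneg) auto
    also have "\<dots> = exp (- L)"
      unfolding exp_of_nat_mult[symmetric] using pos by simp
    finally show ?thesis
      using noise_tail[OF vc r t w] unfolding p_def[symmetric] t_def[symmetric] by linarith
  qed
qed

lemma AE_sample_cube: "AE \<omega> in Om. \<forall>i<n. fst (\<omega> i) \<in> cube d"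
proof -
  have "AE \<omega> in Om. \<forall>i\<in>{..<n}. fst (\<omega> i) \<in> cube d"
    unfolding sample_space_eq
    by (intro eventually_ball_finite ballI AE_PiM_component[where P="\<lambda>z. fst z \<in> cube d"] Q_prob AE_cube) auto
  then show ?thesis by (simp add: Ball_def)
qed

definition split_pairs where "split_pairs = (SIGMA c:relevant_cells S. free_coords d c)"

lemma finite_split_pairs: "finite split_pairs"
  and card_split_pairs: "card split_pairs \<le> 3 ^ s * d"
proof -
  have sub: "split_pairs \<subseteq> relevant_cells S \<times> {..<d}" by (auto simp: split_pairs_def free_coords_def)
  have fin: "finite (relevant_cells S \<times> {..<d})" using finite_relevant_cells[OF S(2)] by simp
  show "finite split_pairs" using finite_subset[OF sub fin] .
  have "card split_pairs \<le> card (relevant_cells S) * d"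
    using card_mono[OF fin sub] by (simp add: card_cartesian_product)
  also have "\<dots> \<le> 3 ^ s * d" using card_relevant_cells[OF S(2)] S(3) by simp
  finally show "card split_pairs \<le> 3 ^ s * d" .
qed

text \<open>Failure is a finite union: a null set of covariates off the cube, and three families
  with total probability at most \<delta>/9 + \<delta>/9 + \<delta>/3.\<close>

lemma bad_measurable: "{\<omega> \<in> space Om. \<not> good \<omega>} \<in> sets Om"
  and bad_prob: "0 < v0 \<Longrightarrow> measure Om {\<omega> \<in> space Om. \<not> good \<omega>} \<le> 5 / 9 * \<delta>"
proof -
  interpret prob_space Om by (rule Om_prob)
  let ?D = "dataset f"
  define E1 where "E1 = (\<lambda>((c, k), r). {\<omega> \<in> space Om. sqrt \<tau> \<le> r * split_dev d n f (?D \<omega>) c k})"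
  \<comment> \<open>Side conditions sit inside the events, so inactive indices give empty events and
    the index sets stay simple products.\<close>
  define E2 where "E2 = (\<lambda>((c, k), z). {\<omega> \<in> space Om. lam \<le> (cond_cov d c f k)\<^sup>2 * (1 / 2) ^ card (dom c) \<and>
      real (cell_count n (?D \<omega>) (c(k \<mapsto> z))) \<le> real n * (1 / 2) ^ card (dom c) / 4})"
  define E3 where "E3 = (\<lambda>(c, r). {\<omega> \<in> space Om. reachable c \<and>
      sqrt (\<rho> * 2 ^ card (dom c)) * real (cell_count n (?D \<omega>) c)
      \<le> r * (\<Sum>i\<in>cell_idx n (?D \<omega>) c. snd (\<omega> i))})"
  define Z where "Z = {\<omega> \<in> space Om. \<exists>i<n. fst (\<omega> i) \<notin> cube d}"
  let ?I = "split_pairs \<times> {1, - 1 :: real}" and ?J = "relevant_cells S \<times> {1, - 1 :: real}"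
  define U1 U2 U3 where "U1 = (\<Union>x\<in>?I. E1 x)" and "U2 = (\<Union>x\<in>?I. E2 x)" and "U3 = (\<Union>x\<in>?J. E3 x)"
  have fin: "finite ?I" "finite ?J"
    using finite_split_pairs finite_relevant_cells[OF S(2)] by auto
  have cards: "real (card ?I) \<le> 2 * 3 ^ s * real d" "real (card ?J) \<le> 2 * 3 ^ s"
  proof -
    have "real (card split_pairs) \<le> real (3 ^ s * d)"
      using card_split_pairs by (rule of_nat_mono)
    then show "real (card ?I) \<le> 2 * 3 ^ s * real d" by (simp add: card_cartesian_product)
    have "real (card (relevant_cells S)) \<le> real (3 ^ s)"
      using card_relevant_cells[OF S(2)] S(3) by (metis of_nat_mono)
    then show "real (card ?J) \<le> 2 * 3 ^ s" by (simp add: card_cartesian_product)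
  qed
  have m1: "E1 x \<in> sets Om" for x
    unfolding E1_def
    by (cases x, cases "fst x", simp, intro borel_measurable_le borel_measurable_const borel_measurable_times
        measurable_split_dev[OF N_sets])
  have m2: "E2 x \<in> sets Om" for x
  proof -
    obtain c k z where x: "x = ((c, k), z)" by (metis surj_pair)
    have "{\<omega> \<in> space Om. real (cell_count n (?D \<omega>) (c(k \<mapsto> z))) \<le> real n * (1 / 2) ^ card (dom c) / 4} \<in> sets Om"
      by (intro borel_measurable_le borel_measurable_const measurable_cell_count[OF N_sets])
    then show ?thesis
      unfolding x E2_def by (cases "lam \<le> (cond_cov d c f k)\<^sup>2 * (1 / 2) ^ card (dom c)") simp_all
  qed
  have m3: "E3 x \<in> sets Om" for x
  proof -
    obtain c r where x: "x = (c, r)" by (metis surj_pair)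
    have "{\<omega> \<in> space Om. sqrt (\<rho> * 2 ^ card (dom c)) * real (cell_count n (?D \<omega>) c)
      \<le> r * (\<Sum>i\<in>cell_idx n (?D \<omega>) c. snd (\<omega> i))} \<in> sets Om"
      by (intro borel_measurable_le borel_measurable_const borel_measurable_times
          measurable_cell_count[OF N_sets] measurable_cell_sum[OF N_sets] measurable_eps[OF N_sets])
    then show ?thesis
      unfolding x E3_def by (cases "reachable c") simp_all
  qed
  have mZ: "Z \<in> sets Om"
  proof -
    have "{\<omega> \<in> space Om. fst (\<omega> i) \<notin> cube d} \<in> sets Om" if "i < n" for i
      using measurable_comp_obs[OF N_sets measurable_fst_obs_pred[where P="\<lambda>x. x \<notin> cube d"] that]
      by (simp only: pred_def)
    moreover have "Z = (\<Union>i\<in>{..<n}. {\<omega> \<in> space Om. fst (\<omega> i) \<notin> cube d})"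
      by (auto simp: Z_def)
    ultimately show ?thesis by (simp only:) (intro sets.finite_UN, auto)
  qed
  have eq: "{\<omega> \<in> space Om. \<not> good \<omega>} = Z \<union> U1 \<union> U2 \<union> U3"
  proof (intro set_eqI)
    fix \<omega> :: "nat \<Rightarrow> (nat \<Rightarrow> real) \<times> real"
    have I: "\<omega> \<notin> (\<Union>x\<in>?I. E x) \<longleftrightarrow> (\<forall>c\<in>relevant_cells S. \<forall>k\<in>free_coords d c. \<forall>r\<in>{1, - 1}. \<omega> \<notin> E ((c, k), r))" for E
      by (auto simp: split_pairs_def)
    have J: "\<omega> \<notin> (\<Union>x\<in>?J. E x) \<longleftrightarrow> (\<forall>c\<in>relevant_cells S. \<forall>r\<in>{1, - 1}. \<omega> \<notin> E (c, r))" for E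
      by auto
    show "\<omega> \<in> {\<omega> \<in> space Om. \<not> good \<omega>} \<longleftrightarrow> \<omega> \<in> Z \<union> U1 \<union> U2 \<union> U3"
    proof (cases "\<omega> \<in> space Om")
      case True
      have e0: "(\<forall>i<n. fst (\<omega> i) \<in> cube d) \<longleftrightarrow> \<omega> \<notin> Z"
        using True by (auto simp: Z_def)
      have e1: "(\<forall>c\<in>relevant_cells S. \<forall>k\<in>free_coords d c. \<bar>split_dev d n f (?D \<omega>) c k\<bar> < sqrt \<tau>)
          \<longleftrightarrow> \<omega> \<notin> U1"
        unfolding U1_def I abs_less_iff_not_le E1_def using True by simp
      have e2: "(\<forall>c\<in>relevant_cells S. \<forall>k\<in>free_coords d c. \<forall>z\<in>{-1, 1}.
            lam \<le> (cond_cov d c f k)\<^sup>2 * (1 / 2) ^ card (dom c) \<longrightarrow>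
            real n * (1 / 2) ^ card (dom c) / 4 < real (cell_count n (?D \<omega>) (c(k \<mapsto> z))))
          \<longleftrightarrow> \<omega> \<notin> U2"
        unfolding U2_def I E2_def insert_commute[of "- 1"] using True
        by (simp only: case_prod_conv mem_Collect_eq de_Morgan_conj not_le simp_thms imp_conv_disj)
      have e3: "(\<forall>c. reachable c \<longrightarrow> \<bar>\<Sum>i\<in>cell_idx n (?D \<omega>) c. snd (\<omega> i)\<bar>
            < sqrt (\<rho> * 2 ^ card (dom c)) * real (cell_count n (?D \<omega>) c))
          \<longleftrightarrow> \<omega> \<notin> U3"
      proof -
        \<comment> \<open>Reachable cells are relevant, so the quantifier over all cells becomes a
          finite one.\<close>
        have "(\<forall>c. reachable c \<longrightarrow> \<not> (\<exists>r\<in>T. P c r))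
            \<longleftrightarrow> (\<forall>c\<in>relevant_cells S. \<forall>r\<in>T. \<not> (reachable c \<and> P c r))" for T :: "real set" and P
          unfolding reachable_def by blast
        then show ?thesis
          unfolding U3_def J E3_def abs_less_iff_not_le case_prod_conv mem_Collect_eq
          using True by (simp only: simp_thms)
      qed
      have "good \<omega> \<longleftrightarrow> \<omega> \<notin> Z \<and> \<omega> \<notin> U1 \<and> \<omega> \<notin> U2 \<and> \<omega> \<notin> U3"
        unfolding good_def e0 e1 e2 e3 ..
      then show ?thesis using True by blast
    next
      case False
      moreover have "U1 \<subseteq> space Om" "U2 \<subseteq> space Om" "U3 \<subseteq> space Om" "Z \<subseteq> space Om"
        by (auto simp: U1_def U2_def U3_def Z_def E1_def E2_def E3_def)
      ultimately show ?thesis by blast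
    qed
  qed
  have mU: "U1 \<in> sets Om" "U2 \<in> sets Om" "U3 \<in> sets Om"
    unfolding U1_def U2_def U3_def using fin m1 m2 m3 by (auto intro!: sets.finite_UN)
  show "{\<omega> \<in> space Om. \<not> good \<omega>} \<in> sets Om"
    unfolding eq using mZ mU by (intro sets.Un)
  assume v: "0 < v0"
  have "AE \<omega> in Om. \<omega> \<notin> Z"
    using AE_sample_cube by eventually_elim (auto simp: Z_def)
  then have pZ: "prob Z = 0" using mZ by (simp add: prob_eq_0)
  have "prob (E1 x) \<le> exp (- Lt)" if x: "x \<in> ?I" for x
  proof -
    obtain c k r where xe: "x = ((c, k), r)" by (metis surj_pair)
    have h: "c \<in> relevant_cells S" "k \<in> free_coords d c" "r = 1 \<or> r = - 1"
      using x xe by (auto simp: split_pairs_def)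
    show ?thesis
      using split_event_prob[OF h(1,2) v h(3)] unfolding xe E1_def case_prod_conv .
  qed
  then have "prob U1 \<le> real (card ?I) * exp (- Lt)"
    unfolding U1_def using fin m1 by (intro prob_UN_le) auto
  also have "\<dots> \<le> 2 * 3 ^ s * real d * exp (- Lt)" using cards(1) by (intro mult_right_mono) auto
  finally have p1: "prob U1 \<le> \<delta> / 9" unfolding exp_Lt .
  have "prob (E2 x) \<le> exp (- Lt)" if x: "x \<in> ?I" for x
  proof -
    obtain c k z where xe: "x = ((c, k), z)" by (metis surj_pair)
    have h: "c \<in> relevant_cells S" "k \<in> free_coords d c" "z = 1 \<or> z = - 1"
      using x xe by (auto simp: split_pairs_def)
    show ?thesis
      using count_event_prob[OF h]
      unfolding xe E2_def by (cases "lam \<le> (cond_cov d c f k)\<^sup>2 * (1 / 2) ^ card (dom c)") simp_all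
  qed
  then have "prob U2 \<le> real (card ?I) * exp (- Lt)"
    unfolding U2_def using fin m2 by (intro prob_UN_le) auto
  also have "\<dots> \<le> 2 * 3 ^ s * real d * exp (- Lt)" using cards(1) by (intro mult_right_mono) auto
  finally have p2: "prob U2 \<le> \<delta> / 9" unfolding exp_Lt .
  have "prob (E3 x) \<le> exp (- L)" if x: "x \<in> ?J" for x
  proof -
    obtain c r where xe: "x = (c, r)" by (metis surj_pair)
    have h: "r = 1 \<or> r = - 1" using x xe by auto
    show ?thesis
      using noise_event_prob[OF _ v h]
      unfolding xe E3_def by (cases "reachable c") simp_all
  qed
  then have "prob U3 \<le> real (card ?J) * exp (- L)"
    unfolding U3_def using fin m3 by (intro prob_UN_le) auto
  also have "\<dots> \<le> 2 * 3 ^ s * exp (- L)" using cards(2) by (intro mult_right_mono) auto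
  finally have p3: "prob U3 \<le> \<delta> / 3" unfolding exp_L .
  have "prob {\<omega> \<in> space Om. \<not> good \<omega>}
      \<le> prob Z + prob U1 + prob U2 + prob U3"
    unfolding eq using mZ mU
    by (intro order.trans[OF measure_Un_le] add_mono sets.Un order.refl)
  then show "prob {\<omega> \<in> space Om. \<not> good \<omega>} \<le> 5 / 9 * \<delta>"
    using pZ p1 p2 p3 by simp
qed

end

section \<open>Risk bounds\<close>

lemma mean_resp_abs_le:
  assumes "\<And>i. i < n \<Longrightarrow> \<bar>snd (D i)\<bar> \<le> A" "0 \<le> A"
  shows "\<bar>mean_resp n D c\<bar> \<le> A"
proof (cases "cell_count n D c = 0")
  case True
  then show ?thesis using assms(2) by (simp add: mean_resp_def)
next
  case False
  have "\<bar>\<Sum>i\<in>cell_idx n D c. snd (D i)\<bar> \<le> (\<Sum>i\<in>cell_idx n D c. \<bar>snd (D i)\<bar>)"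
    by (rule sum_abs)
  also have "\<dots> \<le> real (cell_count n D c) * A"
    unfolding cell_count_def using assms(1) by (intro sum_bounded_above) (auto simp: cell_idx_def)
  finally show ?thesis
    using False by (simp only: mean_resp_def abs_divide) (simp add: field_simps)
qed

lemma cart_eval_abs_le:
  assumes "\<And>i. i < n \<Longrightarrow> \<bar>snd (D i)\<bar> \<le> A" "0 \<le> A"
  shows "\<bar>cart_eval m d n \<gamma> D c x\<bar> \<le> A"
  by (induction m arbitrary: c) (simp_all add: mean_resp_abs_le[OF assms] Let_def)

lemma risk_le:
  assumes "\<And>x. x \<in> cube d \<Longrightarrow> (g x - f x)\<^sup>2 \<le> b"
  shows "risk d g f \<le> b"
proof -
  have "(\<Sum>x\<in>cube d. (g x - f x)\<^sup>2) \<le> real (card (cube d)) * b"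
    using assms by (intro sum_bounded_above) auto
  then show ?thesis
    unfolding risk_def integral_pmf_of_set[OF cube_nonempty finite_cube]
    by (simp add: card_cube field_simps)
qed

text \<open>Truncation at 2 * b. Beyond it, w = b * |y| / 2 satisfies w \<ge> b^2 and w^2 / 2 \<le>
  exp w, and exp w = exp(-w) * exp(2 * w) supplies the small factor exp(-b^2).\<close>

lemma square_le_exp_bound:
  fixes y b :: real
  assumes b: "1 \<le> b"
  shows "y\<^sup>2 \<le> 4 * b\<^sup>2 + 8 * exp (- b\<^sup>2) * (exp (b * y) + exp (- (b * y)))"
proof (cases "\<bar>y\<bar> \<le> 2 * b")
  case True
  then have "\<bar>y\<bar>\<^sup>2 \<le> (2 * b)\<^sup>2" by (intro power_mono) auto
  moreover have "0 \<le> 8 * exp (- b\<^sup>2) * (exp (b * y) + exp (- (b * y)))" by simp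
  moreover have "(2 * b)\<^sup>2 = 4 * b\<^sup>2" by simp
  ultimately show ?thesis unfolding power2_abs by linarith
next
  case False
  define w where "w = b * \<bar>y\<bar> / 2"
  have w0: "0 \<le> w" using b by (simp add: w_def)
  have "w\<^sup>2 / 2 \<le> exp w"
    using exp_lower_Taylor_quadratic[OF w0] w0 by linarith
  moreover have "y\<^sup>2 \<le> b\<^sup>2 * y\<^sup>2"
    using b by (simp add: mult_le_cancel_right1 one_le_power)
  ultimately have "y\<^sup>2 \<le> 8 * exp w"
    by (simp add: w_def power_divide power_mult_distrib)
  also have "exp w = exp (- w) * exp (b * \<bar>y\<bar>)"
    by (simp add: w_def exp_add[symmetric])
  also have "\<dots> \<le> exp (- b\<^sup>2) * exp (b * \<bar>y\<bar>)"
  proof -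
    have "b * (2 * b) \<le> b * \<bar>y\<bar>" using False b by (intro mult_left_mono) auto
    then have "b\<^sup>2 \<le> w" by (simp add: w_def power2_eq_square)
    then show ?thesis by simp
  qed
  also have "\<dots> \<le> exp (- b\<^sup>2) * (exp (b * y) + exp (- (b * y)))"
    by (intro mult_left_mono) (auto simp: abs_if)
  finally show ?thesis by (simp add: add_increasing)
qed

text \<open>The function exp e - 1 - e is nonnegative and vanishes only at 0, while its expectation
  is at most 0.\<close>

lemma subgaussian_degenerate:
  assumes "subgaussian_noise N 0"
  shows "AE e in N. e = 0"
proof -
  interpret prob_space N using assms by (simp add: subgaussian_noise_def)
  have int: "integrable N (\<lambda>e. e)" "integrable N (\<lambda>e. exp e)" "(\<integral>e. e \<partial>N) = 0" "(\<integral>e. exp e \<partial>N) \<le> 1"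
    using assms unfolding subgaussian_noise_def by (auto dest: spec[of _ 1])
  then have int': "integrable N (\<lambda>e. exp e - 1 - e)" by simp
  have nn: "AE e in N. 0 \<le> exp e - 1 - e"
    using exp_ge_add_one_self by (intro AE_I2) (simp add: algebra_simps)
  have "(\<integral>e. exp e - 1 - e \<partial>N) = (\<integral>e. exp e \<partial>N) - 1"
    using int by (simp add: prob_space)
  then have "(\<integral>e. exp e - 1 - e \<partial>N) = 0"
    using int(4) integral_nonneg_AE[OF nn] by linarith
  then have "AE e in N. exp e - 1 - e = 0"
    using integral_nonneg_eq_0_iff_AE[OF int' nn] by simp
  then show ?thesis
  proof eventually_elim
    case (elim e)
    show ?case
    proof (rule ccontr)
      assume e: "e \<noteq> 0"
      \<comment> \<open>Squaring exp(e/2) \<ge> 1 + e/2 gains the term e^2 / 4, which makes the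
        tangent inequality strict.\<close>
      have h: "exp e = (exp (e / 2))\<^sup>2" by (simp add: power2_eq_square exp_add[symmetric])
      show False
      proof (cases "0 \<le> 1 + e / 2")
        case True
        have "(1 + e / 2)\<^sup>2 \<le> (exp (e / 2))\<^sup>2"
          using True exp_ge_add_one_self[of "e / 2"] by (intro power_mono) auto
        moreover have "(1 + e / 2)\<^sup>2 = 1 + e + e\<^sup>2 / 4"
          by (simp add: power2_eq_square algebra_simps)
        ultimately show False using elim e zero_less_power2[of e] unfolding h by linarith
      next
        case False
        then show False using elim exp_gt_zero[of e] by linarith
      qed
    qed
  qed
qed

section \<open>Risk with high probability and in expectation\<close>

context cart_model
begin

text \<open>The condition n > 8 * \<tau> / lam says that sqrt(\<tau>/n) is less than half of
  sqrt(lam/2), so \<open>\<gamma> = \<tau> / n\<close> is admissible.\<close>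

lemma gamma_exists:
  "\<tau> / real n < (max 0 (sqrt (lam / 2) - sqrt (\<tau> / real n)))\<^sup>2"
proof -
  have tn: "0 \<le> \<tau> / real n" using tau_nonneg by simp
  have "\<tau> / real n < lam / 2 / 4" using n_lam pos by (simp add: field_simps)
  then have "sqrt (\<tau> / real n) < sqrt (lam / 2 / 4)" by simp
  also have "\<dots> = sqrt (lam / 2) / 2" by (simp only: real_sqrt_divide real_sqrt_four)
  finally have lt: "sqrt (\<tau> / real n) < max 0 (sqrt (lam / 2) - sqrt (\<tau> / real n))" by simp
  have "(sqrt (\<tau> / real n))\<^sup>2 < (max 0 (sqrt (lam / 2) - sqrt (\<tau> / real n)))\<^sup>2"
    using tn by (intro power_strict_mono[OF lt]) auto
  then show ?thesis using tn by simp
qed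

lemma degenerate_risk:
  assumes "\<not> 0 < v0"
  shows "AE \<omega> in Om. risk d (cart d n \<gamma> (dataset f \<omega>)) f = 0"
proof -
  have z: "B\<^sup>2 = 0" "\<sigma>\<^sup>2 = 0"
    using assms zero_le_power2[of B] zero_le_power2[of \<sigma>] unfolding v0_def by linarith+
  then have "AE e in N. e = 0" using noise subgaussian_degenerate by simp
  then have "AE z in Q. snd z = 0"
  proof -
    interpret pair_prob_space "measure_pmf (pmf_of_set (cube d))" N
      using N_prob by (simp add: pair_prob_space_def pair_sigma_finite_def
          prob_space_imp_sigma_finite measure_pmf.prob_space_axioms)
    have "{z \<in> space Q. snd z = 0} \<in> sets Q"
      by (intro borel_measurable_eq borel_measurable_const measurable_snd_obs[OF N_sets])
    then show ?thesis
      unfolding obs_space_def using \<open>AE e in N. e = 0\<close> by (intro AE_pair_measure) auto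
  qed
  then have "AE \<omega> in Om. \<forall>i\<in>{..<n}. snd (\<omega> i) = 0"
    unfolding sample_space_eq
    by (intro eventually_ball_finite ballI AE_PiM_component[where P="\<lambda>z. snd z = 0"] Q_prob) auto
  then show ?thesis
    using AE_sample_cube
  proof eventually_elim
    case (elim \<omega>)
    have f0: "f x = 0" if "x \<in> cube d" for x using f_le[OF that] z by simp
    have "\<bar>snd (dataset f \<omega> i)\<bar> \<le> 0" if "i < n" for i
      using that elim f0 by (simp add: dataset_def)
    then have "cart d n \<gamma> (dataset f \<omega>) x = 0" for x
      using cart_eval_abs_le[of n "dataset f \<omega>" 0] by (simp add: cart_def)
    then have "risk d (cart d n \<gamma> (dataset f \<omega>)) f = measure_pmf.expectation (pmf_of_set (cube d)) (\<lambda>x. (f x)\<^sup>2)"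
      by (simp add: risk_def)
    also have "\<dots> = 0"
      unfolding integral_pmf_of_set[OF cube_nonempty finite_cube] by (simp add: f0)
    finally show ?case .
  qed
qed

lemma rho_nonneg: "0 \<le> \<rho>"
  using L_pos by (auto simp: \<rho>_def intro!: divide_nonneg_nonneg mult_nonneg_nonneg)

lemma high_probability_bound:
  assumes gam: "\<tau> / real n \<le> \<gamma>" "\<gamma> < (max 0 (sqrt (lam / 2) - sqrt (\<tau> / real n)))\<^sup>2"
  shows "1 - \<delta> \<le> measure Om {\<omega> \<in> space Om. risk d (cart d n \<gamma> (dataset f \<omega>)) f \<le> \<rho> * 2 ^ s}"
proof -
  interpret prob_space Om by (rule Om_prob)
  let ?R = "{\<omega> \<in> space Om. risk d (cart d n \<gamma> (dataset f \<omega>)) f \<le> \<rho> * 2 ^ s}"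
  have m: "?R \<in> events"
    by (intro borel_measurable_le borel_measurable_const measurable_risk_cart[OF N_sets])
  show ?thesis
  proof (cases "0 < v0")
    case True
    have "1 - 5 / 9 * \<delta> \<le> 1 - prob {\<omega> \<in> space Om. \<not> good \<omega>}"
      using bad_prob[OF True] by simp
    also have "\<dots> = prob (space Om - {\<omega> \<in> space Om. \<not> good \<omega>})"
      by (rule prob_compl[OF bad_measurable, symmetric])
    also have "\<dots> \<le> prob ?R"
      using cart_error[OF gam] by (intro finite_measure_mono m) (auto intro!: risk_le)
    finally show ?thesis using delta by simp
  next
    case False
    have "0 \<le> \<rho> * 2 ^ s" using rho_nonneg by simp
    have "AE \<omega> in Om. \<omega> \<in> ?R"
      using degenerate_risk[OF False, of \<gamma>] AE_space
      by eventually_elim (use \<open>0 \<le> \<rho> * 2 ^ s\<close> in simp)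
    then have "prob ?R = 1" using m by (simp add: prob_eq_1)
    then show ?thesis using delta by simp
  qed
qed

lemma nn_integral_exp_noise:
  assumes i: "i < n"
  shows "(\<integral>\<^sup>+\<omega>. ennreal (exp (a * snd (\<omega> i))) \<partial>Om) \<le> ennreal (exp (\<sigma>\<^sup>2 * a\<^sup>2 / 2))"
proof -
  interpret Q: prob_space Q by (rule Q_prob)
  interpret product_prob_space "\<lambda>_. Q" "{..<n}" by unfold_locales
  let ?g = "\<lambda>z :: (nat \<Rightarrow> real) \<times> real. ennreal (exp (a * snd z))"
  have g: "?g \<in> borel_measurable Q"
    by (rule measurable_compose[OF measurable_snd_obs[OF N_sets] measurable_exp_scale])
  \<comment> \<open>A function of one coordinate is viewed as a product with factors 1
    elsewhere.\<close>
  have "(\<integral>\<^sup>+\<omega>. ?g (\<omega> i) \<partial>Om) = (\<integral>\<^sup>+\<omega>. (\<Prod>j<n. if j = i then ?g (\<omega> j) else 1) \<partial>Om)"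
    using i by (simp add: prod.delta)
  also have "\<dots> = (\<Prod>j<n. \<integral>\<^sup>+z. (if j = i then ?g z else 1) \<partial>Q)"
    unfolding sample_space_eq using g by (intro product_nn_integral_prod) auto
  also have "\<dots> = (\<Prod>j<n. if j = i then \<integral>\<^sup>+z. ?g z \<partial>Q else 1)"
    by (intro prod.cong) (auto simp: Q.emeasure_space_1)
  also have "\<dots> = (\<integral>\<^sup>+z. ?g z \<partial>Q)" using i by (simp add: prod.delta)
  also have "\<dots> = (\<integral>\<^sup>+z. ennreal ((\<lambda>_. 1) (fst z)) * ennreal (exp (a * snd z)) \<partial>Q)" by simp
  also have "\<dots> = ennreal ((\<Sum>x\<in>cube d. 1) / 2 ^ d) * (\<integral>\<^sup>+e. ennreal (exp (a * e)) \<partial>N)"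
    by (rule nn_integral_obs[OF N_prob N_sets _ measurable_exp_scale]) simp
  also have "\<dots> = (\<integral>\<^sup>+e. ennreal (exp (a * e)) \<partial>N)" by (simp add: card_cube)
  finally show ?thesis using subgaussian_nn_integral[OF noise, of a] by simp
qed

text \<open>Off the good event the error is controlled by the largest noise term, whose square exceeds
  a multiple of \<open>v0 * b^2\<close> only through exponentially small contributions.\<close>
lemma expected_risk_bound:
  assumes gam: "\<tau> / real n \<le> \<gamma>" "\<gamma> < (max 0 (sqrt (lam / 2) - sqrt (\<tau> / real n)))\<^sup>2"
    and v: "0 < v0" and b: "1 \<le> b"
  shows "(\<integral>\<^sup>+\<omega>. ennreal (risk d (cart d n \<gamma> (dataset f \<omega>)) f) \<partial>Om)
    \<le> ennreal (\<rho> * 2 ^ s + v0 * (6 + 16 * b\<^sup>2) * \<delta> + 64 * v0 * real n * exp (- (b\<^sup>2 / 2)))"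
proof -
  interpret prob_space Om by (rule Om_prob)
  \<comment> \<open>Dividing the noise by \<open>sqrt v0\<close> gives it proxy at most 1, since
    \<sigma>^2 \<le> v0.\<close>
  define \<beta> where "\<beta> = b / sqrt v0"
  define c3 where "c3 = 32 * v0 * exp (- b\<^sup>2)"
  define c2 where "c2 = v0 * (6 + 16 * b\<^sup>2)"
  define bad where "bad = {\<omega> \<in> space Om. \<not> good \<omega>}"
  define X where "X = (\<lambda>i (\<omega> :: nat \<Rightarrow> (nat \<Rightarrow> real) \<times> real). c3 * exp (\<beta> * snd (\<omega> i)) + c3 * exp (- \<beta> * snd (\<omega> i)))"
  have c: "0 \<le> c2" "0 \<le> c3" using v by (auto simp: c2_def c3_def)
  have X0: "0 \<le> X i \<omega>" for i \<omega> using c by (simp add: X_def)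
  have \<beta>2: "\<sigma>\<^sup>2 * \<beta>\<^sup>2 / 2 \<le> b\<^sup>2 / 2"
  proof -
    have "\<beta>\<^sup>2 = b\<^sup>2 / v0" using v by (simp add: \<beta>_def power_divide)
    moreover have "\<sigma>\<^sup>2 * b\<^sup>2 \<le> v0 * b\<^sup>2" by (intro mult_right_mono) (auto simp: v0_def)
    ultimately show ?thesis using v by (simp add: pos_divide_le_eq mult.commute)
  qed
  have eps: "4 * (snd (\<omega> i))\<^sup>2 \<le> 16 * v0 * b\<^sup>2 + X i \<omega>" for \<omega> i
  proof -
    define y where "y = snd (\<omega> i) / sqrt v0"
    have y: "(snd (\<omega> i))\<^sup>2 = v0 * y\<^sup>2" "b * y = \<beta> * snd (\<omega> i)"
      using v by (auto simp: y_def \<beta>_def power_divide)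
    have "4 * v0 * y\<^sup>2 \<le> 4 * v0 * (4 * b\<^sup>2 + 8 * exp (- b\<^sup>2) * (exp (b * y) + exp (- (b * y))))"
      using v by (intro mult_left_mono square_le_exp_bound b) auto
    also have "\<dots> = 16 * v0 * b\<^sup>2 + X i \<omega>"
      unfolding X_def c3_def y(2) by (simp add: algebra_simps)
    finally show ?thesis by (simp add: y(1))
  qed
  have risk_bad: "risk d (cart d n \<gamma> (dataset f \<omega>)) f \<le> c2 + (\<Sum>i<n. X i \<omega>)"
    if cube: "\<forall>i<n. fst (\<omega> i) \<in> cube d" for \<omega>
  proof (rule risk_le)
    fix x assume x: "x \<in> cube d"
    \<comment> \<open>\<open>V\<close> dominates every squared noise term, so all responses, and
      hence all tree predictions, are at most B + sqrt V in absolute value.\<close>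
    define V where "V = 4 * v0 * b\<^sup>2 + (\<Sum>i<n. X i \<omega>) / 4"
    have V0: "0 \<le> V" using v X0 by (auto simp: V_def intro!: add_nonneg_nonneg sum_nonneg)
    have "\<bar>snd (dataset f \<omega> i)\<bar> \<le> B + sqrt V" if i: "i < n" for i
    proof -
      have "X i \<omega> \<le> (\<Sum>i<n. X i \<omega>)" using i X0 by (intro member_le_sum) auto
      then have "(snd (\<omega> i))\<^sup>2 \<le> V" using eps[of \<omega> i] by (simp add: V_def)
      then have "\<bar>snd (\<omega> i)\<bar> \<le> sqrt V" using real_sqrt_le_mono by fastforce
      moreover have "\<bar>f (fst (\<omega> i))\<bar> \<le> B" using cube i by (intro f_le) auto
      ultimately show ?thesis by (simp add: dataset_def)
    qed
    then have "\<bar>cart d n \<gamma> (dataset f \<omega>) x\<bar> \<le> B + sqrt V"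
      unfolding cart_def using B_nonneg V0 by (intro cart_eval_abs_le) auto
    then have "\<bar>cart d n \<gamma> (dataset f \<omega>) x - f x\<bar> \<le> 2 * B + sqrt V"
      using f_le[OF x] by linarith
    then have "\<bar>cart d n \<gamma> (dataset f \<omega>) x - f x\<bar>\<^sup>2 \<le> (2 * B + sqrt V)\<^sup>2"
      by (intro power_mono) auto
    also have "\<dots> \<le> 6 * B\<^sup>2 + 4 * V"
    proof -
      \<comment> \<open>This is exactly 6 * B^2 + 4 * V - (2 * B + sqrt V)^2.\<close>
      have "0 \<le> 2 * (B - sqrt V)\<^sup>2 + (sqrt V)\<^sup>2" by simp
      then have "(2 * B + sqrt V)\<^sup>2 \<le> 6 * B\<^sup>2 + 4 * (sqrt V)\<^sup>2"
        by (simp add: power2_eq_square algebra_simps)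
      then show ?thesis using V0 by simp
    qed
    also have "\<dots> \<le> 6 * v0 + 4 * V" by (simp add: v0_def)
    also have "\<dots> = c2 + (\<Sum>i<n. X i \<omega>)" by (simp add: V_def c2_def algebra_simps)
    finally show "(cart d n \<gamma> (dataset f \<omega>) x - f x)\<^sup>2 \<le> c2 + (\<Sum>i<n. X i \<omega>)" by simp
  qed
  \<comment> \<open>The indicator multiplies the constant part only. The noise terms are nonnegative
    and are kept for every \<open>\<omega>\<close>, which avoids integrating a product of noise and
    bad event.\<close>
  let ?G = "\<lambda>\<omega>. ennreal (\<rho> * 2 ^ s) + ennreal c2 * indicator bad \<omega> + (\<Sum>i<n. ennreal (X i \<omega>))"
  have Xm: "(\<lambda>\<omega>. ennreal (exp (a * snd (\<omega> i)))) \<in> borel_measurable Om" if "i < n" for i a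
    by (rule measurable_compose[OF measurable_eps[OF N_sets that] measurable_exp_scale])
  have Xe: "ennreal (X i \<omega>) = ennreal c3 * ennreal (exp (\<beta> * snd (\<omega> i))) + ennreal c3 * ennreal (exp (- \<beta> * snd (\<omega> i)))" for i \<omega>
    using c by (simp add: X_def ennreal_plus ennreal_mult')
  have XM: "(\<lambda>\<omega>. ennreal (X i \<omega>)) \<in> borel_measurable Om" if "i < n" for i
    unfolding Xe using that by (intro borel_measurable_add borel_measurable_times_ennreal Xm borel_measurable_const)
  have XI: "(\<integral>\<^sup>+\<omega>. ennreal (X i \<omega>) \<partial>Om) \<le> ennreal (2 * c3 * exp (b\<^sup>2 / 2))" if i: "i < n" for i
  proof -
    have e: "(\<integral>\<^sup>+\<omega>. ennreal (exp (a * snd (\<omega> i))) \<partial>Om) \<le> ennreal (exp (b\<^sup>2 / 2))" if "a = \<beta> \<or> a = - \<beta>" for a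
      using nn_integral_exp_noise[OF i, of a] \<beta>2 that by (force intro: order.trans ennreal_leI)
    have "(\<integral>\<^sup>+\<omega>. ennreal (X i \<omega>) \<partial>Om) = ennreal c3 * (\<integral>\<^sup>+\<omega>. ennreal (exp (\<beta> * snd (\<omega> i))) \<partial>Om)
        + ennreal c3 * (\<integral>\<^sup>+\<omega>. ennreal (exp (- \<beta> * snd (\<omega> i))) \<partial>Om)"
      unfolding Xe using Xm[OF i]
      by (simp only: nn_integral_add nn_integral_cmult borel_measurable_times_ennreal borel_measurable_const)
    also have "\<dots> \<le> ennreal c3 * ennreal (exp (b\<^sup>2 / 2)) + ennreal c3 * ennreal (exp (b\<^sup>2 / 2))"
      by (intro add_mono mult_left_mono e) auto
    also have "\<dots> = ennreal (2 * c3 * exp (b\<^sup>2 / 2))"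
      using c by (simp add: ennreal_mult'[symmetric] ennreal_plus[symmetric] del: ennreal_plus)
    finally show ?thesis .
  qed
  have badm: "bad \<in> events" unfolding bad_def by (rule bad_measurable)
  have "AE \<omega> in Om. ennreal (risk d (cart d n \<gamma> (dataset f \<omega>)) f) \<le> ?G \<omega>"
    using AE_sample_cube AE_space
  proof eventually_elim
    case (elim \<omega>)
    have "risk d (cart d n \<gamma> (dataset f \<omega>)) f \<le> \<rho> * 2 ^ s + c2 * indicator bad \<omega> + (\<Sum>i<n. X i \<omega>)"
    proof (cases "good \<omega>")
      case True
      have "risk d (cart d n \<gamma> (dataset f \<omega>)) f \<le> \<rho> * 2 ^ s"
        by (rule risk_le) (rule cart_error[OF gam True])
      moreover have "0 \<le> (\<Sum>i<n. X i \<omega>)" by (intro sum_nonneg X0)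
      moreover have "\<omega> \<notin> bad" using True by (simp add: bad_def)
      ultimately show ?thesis by simp
    next
      case False
      then have "\<omega> \<in> bad" using elim by (simp add: bad_def)
      moreover have "0 \<le> \<rho> * 2 ^ s" using rho_nonneg by simp
      ultimately show ?thesis using risk_bad[of \<omega>] elim by simp
    qed
    then have "ennreal (risk d (cart d n \<gamma> (dataset f \<omega>)) f)
        \<le> ennreal (\<rho> * 2 ^ s + c2 * indicator bad \<omega> + (\<Sum>i<n. X i \<omega>))" by (rule ennreal_leI)
    also have "\<dots> = ennreal (\<rho> * 2 ^ s) + ennreal (c2 * indicator bad \<omega>) + ennreal (\<Sum>i<n. X i \<omega>)"
    proof -
      have "0 \<le> \<rho> * 2 ^ s" "0 \<le> c2 * indicator bad \<omega>" "0 \<le> (\<Sum>i<n. X i \<omega>)"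
        using c rho_nonneg X0 by (auto intro: sum_nonneg)
      then show ?thesis by (simp only: ennreal_plus add_nonneg_nonneg)
    qed
    also have "ennreal (c2 * indicator bad \<omega>) = ennreal c2 * indicator bad \<omega>"
      by (cases "\<omega> \<in> bad") simp_all
    also have "ennreal (\<Sum>i<n. X i \<omega>) = (\<Sum>i<n. ennreal (X i \<omega>))"
      by (rule sum_ennreal[symmetric]) (rule X0)
    finally show ?case .
  qed
  then have "(\<integral>\<^sup>+\<omega>. ennreal (risk d (cart d n \<gamma> (dataset f \<omega>)) f) \<partial>Om) \<le> (\<integral>\<^sup>+\<omega>. ?G \<omega> \<partial>Om)"
    by (rule nn_integral_mono_AE)
  also have "\<dots> = ennreal (\<rho> * 2 ^ s) + ennreal c2 * emeasure Om bad + (\<Sum>i<n. \<integral>\<^sup>+\<omega>. ennreal (X i \<omega>) \<partial>Om)"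
    using badm XM by (subst nn_integral_add; (subst nn_integral_add)?; (subst nn_integral_sum)?)
      (auto simp: emeasure_space_1 nn_integral_cmult intro!: borel_measurable_sum)
  also have "\<dots> \<le> ennreal (\<rho> * 2 ^ s) + ennreal c2 * ennreal \<delta> + (\<Sum>i<n. ennreal (2 * c3 * exp (b\<^sup>2 / 2)))"
  proof (intro add_mono mult_left_mono sum_mono XI order.refl)
    have "measure Om bad \<le> \<delta>" using bad_prob[OF v] delta unfolding bad_def by linarith
    then show "emeasure Om bad \<le> ennreal \<delta>" by (simp add: emeasure_eq_measure ennreal_leI)
  qed auto
  also have "(\<Sum>i<n. ennreal (2 * c3 * exp (b\<^sup>2 / 2))) = ennreal (real n * (2 * c3 * exp (b\<^sup>2 / 2)))"
    using c by (subst sum_ennreal) auto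
  also have "ennreal (\<rho> * 2 ^ s) + ennreal c2 * ennreal \<delta> + ennreal (real n * (2 * c3 * exp (b\<^sup>2 / 2)))
      = ennreal (\<rho> * 2 ^ s + c2 * \<delta> + real n * (2 * c3 * exp (b\<^sup>2 / 2)))"
    using c rho_nonneg delta by (simp add: ennreal_plus ennreal_mult')
  also have "real n * (2 * c3 * exp (b\<^sup>2 / 2)) = 64 * v0 * real n * exp (- (b\<^sup>2 / 2))"
  proof -
    have "exp (- b\<^sup>2) * exp (b\<^sup>2 / 2) = exp (- (b\<^sup>2 / 2))" by (simp add: exp_add[symmetric])
    then show ?thesis by (simp add: c3_def mult_ac)
  qed
  finally show ?thesis by (simp only: c2_def)
qed

lemma expected_risk_rate:
  assumes gam: "\<tau> / real n \<le> \<gamma>" "\<gamma> < (max 0 (sqrt (lam / 2) - sqrt (\<tau> / real n)))\<^sup>2"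
    and \<delta>: "\<delta> = 1 / real n"
  shows "(\<integral>\<^sup>+\<omega>. ennreal (risk d (cart d n \<gamma> (dataset f \<omega>)) f) \<partial>Om)
    \<le> ennreal (100 * 2 ^ s * (B\<^sup>2 + \<sigma>\<^sup>2) * (real s + ln (real n)) / real n)"
proof (cases "0 < v0")
  case False
  have "(\<integral>\<^sup>+\<omega>. ennreal (risk d (cart d n \<gamma> (dataset f \<omega>)) f) \<partial>Om) = (\<integral>\<^sup>+\<omega>. 0 \<partial>Om)"
    using degenerate_risk[OF False, of \<gamma>] by (intro nn_integral_cong_AE) (auto elim!: eventually_mono)
  then show ?thesis by simp
next
  case True
  define l where "l = ln (real n)"
  \<comment> \<open>4 * ln n makes exp(-b^2 / 2) at most 1/n^2, so the sum of n noise tails is of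
    order 1/n; the added 1 ensures b \<ge> 1 even for n = 1.\<close>
  define b where "b = sqrt (4 * l + 1)"
  have n1: "1 \<le> real n" "1 \<le> real s" using pos by auto
  have l0: "0 \<le> l" using n1 by (simp add: l_def)
  have b2: "b\<^sup>2 = 4 * l + 1" and b1: "1 \<le> b" using l0 by (auto simp: b_def)
  have "exp (- (b\<^sup>2 / 2)) \<le> exp (- (2 * l))" unfolding b2 by simp
  also have "\<dots> = 1 / (real n)\<^sup>2"
    using n1 by (simp add: l_def exp_minus exp_double[of "ln (real n)"] inverse_eq_divide)
  finally have "64 * v0 * real n * exp (- (b\<^sup>2 / 2)) \<le> 64 * v0 * real n * (1 / (real n)\<^sup>2)"
    using True by (intro mult_left_mono) auto
  also have "\<dots> = v0 * 64 / real n" using n1 by (simp add: power2_eq_square)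
  finally have t3: "64 * v0 * real n * exp (- (b\<^sup>2 / 2)) \<le> v0 * 64 / real n" .
  have ln3: "ln 3 \<le> (2::real)" and ln2: "ln 2 \<le> (1::real)"
    using ln_le_minus_one[of "3::real"] ln_le_minus_one[of "2::real"] by auto
  have "ln (2 / \<delta>) = ln 2 + l"
    using n1 by (simp add: \<delta> l_def ln_mult)
  then have "L = (real s + 1) * ln 3 + (ln 2 + l)"
    by (simp add: L_def)
  also have "\<dots> \<le> (real s + 1) * 2 + (1 + l)"
    using ln3 ln2 by (intro add_mono mult_left_mono) auto
  also have "\<dots> \<le> 5 * real s + l" using n1 by simp
  finally have L: "L \<le> 5 * real s + l" .
  have "\<rho> * 2 ^ s = v0 * (2 ^ s * (2 * L)) / real n" by (simp add: \<rho>_def v0_def)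
  also have "\<dots> \<le> v0 * (2 ^ s * (2 * (5 * real s + l))) / real n"
    using L True by (intro divide_right_mono mult_left_mono) auto
  finally have t1: "\<rho> * 2 ^ s \<le> v0 * (2 ^ s * (2 * (5 * real s + l))) / real n" .
  have t2: "v0 * (6 + 16 * b\<^sup>2) * \<delta> = v0 * (22 + 64 * l) / real n"
    by (simp add: b2 \<delta> algebra_simps add_divide_distrib)
  \<comment> \<open>86 = 22 + 64 collects the additive constants, absorbed using s \<ge> 1. Adding
    10 * s + 2 * l from the good event gives 96 * s + 66 * l, hence the constant 100.\<close>
  have pw: "86 + 64 * l \<le> 2 ^ s * (86 * real s + 64 * l)"
  proof -
    have "1 * (86 * real s + 64 * l) \<le> 2 ^ s * (86 * real s + 64 * l)"
      using l0 by (intro mult_right_mono) auto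
    then show ?thesis using n1 by simp
  qed
  have "\<rho> * 2 ^ s + v0 * (6 + 16 * b\<^sup>2) * \<delta> + 64 * v0 * real n * exp (- (b\<^sup>2 / 2))
      \<le> v0 * (2 ^ s * (2 * (5 * real s + l))) / real n + v0 * (22 + 64 * l) / real n + v0 * 64 / real n"
    using t1 t2 t3 by linarith
  also have "\<dots> = v0 * (2 ^ s * (10 * real s + 2 * l) + (86 + 64 * l)) / real n"
    by (simp add: add_divide_distrib[symmetric] algebra_simps)
  also have "\<dots> \<le> v0 * (2 ^ s * (100 * (real s + l))) / real n"
  proof -
    have "2 ^ s * (10 * real s + 2 * l) + (86 + 64 * l) \<le> 2 ^ s * (10 * real s + 2 * l) + 2 ^ s * (86 * real s + 64 * l)"
      using pw by simp
    also have "\<dots> = 2 ^ s * (96 * real s + 66 * l)" by (simp add: algebra_simps)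
    also have "\<dots> \<le> 2 ^ s * (100 * (real s + l))" using l0 n1 by (intro mult_left_mono) auto
    finally show ?thesis using True by (intro divide_right_mono mult_left_mono) auto
  qed
  also have "\<dots> = 100 * 2 ^ s * (B\<^sup>2 + \<sigma>\<^sup>2) * (real s + ln (real n)) / real n"
    by (simp add: v0_def l_def)
  finally show ?thesis
    using expected_risk_bound[OF gam True b1] by (meson ennreal_leI order.trans)
qed

end

theorem theoremH3:
  fixes d s n :: nat and f0 :: "(nat \<Rightarrow> real) \<Rightarrow> real" and S :: "nat set"
    and N :: "real measure" and \<sigma> lam \<delta> :: real
  assumes setting: "model_setting d s n f0 S N \<sigma> lam"
    and \<delta>: "0 < \<delta>" "\<delta> < 1"
    and n_large: "real n > 8 * tau d s (supnorm d (fstar_of f0 S s)) \<sigma> \<delta> / lam"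
  shows
    "(\<exists>\<gamma>. tau d s (supnorm d (fstar_of f0 S s)) \<sigma> \<delta> / real n \<le> \<gamma> \<and>
          \<gamma> < (max 0 (sqrt (lam / 2) - sqrt (tau d s (supnorm d (fstar_of f0 S s)) \<sigma> \<delta> / real n)))^2)
   \<and> (\<forall>\<gamma>. tau d s (supnorm d (fstar_of f0 S s)) \<sigma> \<delta> / real n \<le> \<gamma> \<longrightarrow>
          \<gamma> < (max 0 (sqrt (lam / 2) - sqrt (tau d s (supnorm d (fstar_of f0 S s)) \<sigma> \<delta> / real n)))^2 \<longrightarrow>
          measure (sample_space d n N)
            {\<omega> \<in> space (sample_space d n N).
               risk d (cart d n \<gamma> (dataset (fstar_of f0 S s) \<omega>)) (fstar_of f0 S s)
               \<le> 2 ^ (s + 1) * ((supnorm d (fstar_of f0 S s))^2 + \<sigma>^2)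
                   * ((real s + 1) * ln 3 + ln (2 / \<delta>)) / real n}
          \<ge> 1 - \<delta> - exp (real s * ln 3 - real n * 2 powr (- (real s + 3))))
   \<and> (\<exists>C>0. \<forall>(d'::nat) (s'::nat) (n'::nat) (f0'::(nat \<Rightarrow> real) \<Rightarrow> real) (S'::nat set)
               (N'::real measure) (\<sigma>'::real) (lam'::real) (\<gamma>'::real).
          model_setting d' s' n' f0' S' N' \<sigma>' lam' \<longrightarrow>
          real n' > 8 * tau d' s' (supnorm d' (fstar_of f0' S' s')) \<sigma>' (1 / real n') / lam' \<longrightarrow>
          tau d' s' (supnorm d' (fstar_of f0' S' s')) \<sigma>' (1 / real n') / real n' \<le> \<gamma>' \<longrightarrow>
          \<gamma>' < (max 0 (sqrt (lam' / 2)
                 - sqrt (tau d' s' (supnorm d' (fstar_of f0' S' s')) \<sigma>' (1 / real n') / real n')))^2 \<longrightarrow>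
          (\<integral>\<^sup>+ \<omega>. ennreal (risk d' (cart d' n' \<gamma>' (dataset (fstar_of f0' S' s') \<omega>)) (fstar_of f0' S' s'))
              \<partial>sample_space d' n' N')
          \<le> ennreal (C * 2 ^ s' * ((supnorm d' (fstar_of f0' S' s'))^2 + \<sigma>'^2)
                       * (real s' + ln (real n')) / real n'))"
proof (intro conjI)
  interpret m: cart_model d s n f0 S N \<sigma> lam \<delta>
    using setting \<delta> n_large by unfold_locales auto
  note defs = m.f_def[symmetric] m.B_def[symmetric] m.\<tau>_def[symmetric]
  show "\<exists>\<gamma>. tau d s (supnorm d (fstar_of f0 S s)) \<sigma> \<delta> / real n \<le> \<gamma> \<and>
          \<gamma> < (max 0 (sqrt (lam / 2) - sqrt (tau d s (supnorm d (fstar_of f0 S s)) \<sigma> \<delta> / real n)))^2"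
    unfolding defs using m.gamma_exists by blast
  have bound: "2 ^ (s + 1) * (m.B\<^sup>2 + \<sigma>\<^sup>2) * ((real s + 1) * ln 3 + ln (2 / \<delta>)) / real n = m.\<rho> * 2 ^ s"
    by (simp add: m.\<rho>_def m.L_def)
  show "\<forall>\<gamma>. tau d s (supnorm d (fstar_of f0 S s)) \<sigma> \<delta> / real n \<le> \<gamma> \<longrightarrow>
          \<gamma> < (max 0 (sqrt (lam / 2) - sqrt (tau d s (supnorm d (fstar_of f0 S s)) \<sigma> \<delta> / real n)))^2 \<longrightarrow>
          measure (sample_space d n N)
            {\<omega> \<in> space (sample_space d n N).
               risk d (cart d n \<gamma> (dataset (fstar_of f0 S s) \<omega>)) (fstar_of f0 S s)
               \<le> 2 ^ (s + 1) * ((supnorm d (fstar_of f0 S s))^2 + \<sigma>^2)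
                   * ((real s + 1) * ln 3 + ln (2 / \<delta>)) / real n}
          \<ge> 1 - \<delta> - exp (real s * ln 3 - real n * 2 powr (- (real s + 3)))"
    unfolding defs bound
  proof (intro allI impI)
    fix \<gamma> assume "m.\<tau> / real n \<le> \<gamma>" "\<gamma> < (max 0 (sqrt (lam / 2) - sqrt (m.\<tau> / real n)))\<^sup>2"
    \<comment> \<open>The level 1 - \<delta> exceeds the stated one because the subtracted
      exponential is positive.\<close>
    from m.high_probability_bound[OF this]
    show "1 - \<delta> - exp (real s * ln 3 - real n * 2 powr (- (real s + 3)))
      \<le> measure (sample_space d n N) {\<omega> \<in> space (sample_space d n N).
            risk d (cart d n \<gamma> (dataset m.f \<omega>)) m.f \<le> m.\<rho> * 2 ^ s}"
      using exp_gt_zero[of "real s * ln 3 - real n * 2 powr (- (real s + 3))"] by linarith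
  qed
next
  show "\<exists>C>0. \<forall>(d'::nat) (s'::nat) (n'::nat) (f0'::(nat \<Rightarrow> real) \<Rightarrow> real) (S'::nat set)
               (N'::real measure) (\<sigma>'::real) (lam'::real) (\<gamma>'::real).
          model_setting d' s' n' f0' S' N' \<sigma>' lam' \<longrightarrow>
          real n' > 8 * tau d' s' (supnorm d' (fstar_of f0' S' s')) \<sigma>' (1 / real n') / lam' \<longrightarrow>
          tau d' s' (supnorm d' (fstar_of f0' S' s')) \<sigma>' (1 / real n') / real n' \<le> \<gamma>' \<longrightarrow>
          \<gamma>' < (max 0 (sqrt (lam' / 2)
                 - sqrt (tau d' s' (supnorm d' (fstar_of f0' S' s')) \<sigma>' (1 / real n') / real n')))^2 \<longrightarrow>
          (\<integral>\<^sup>+ \<omega>. ennreal (risk d' (cart d' n' \<gamma>' (dataset (fstar_of f0' S' s') \<omega>)) (fstar_of f0' S' s'))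
              \<partial>sample_space d' n' N')
          \<le> ennreal (C * 2 ^ s' * ((supnorm d' (fstar_of f0' S' s'))^2 + \<sigma>'^2)
                       * (real s' + ln (real n')) / real n')"
  proof (intro exI[of _ "100::real"] conjI allI impI)
    fix d' s' n' :: nat and f0' :: "(nat \<Rightarrow> real) \<Rightarrow> real" and S' :: "nat set"
      and N' :: "real measure" and \<sigma>' lam' \<gamma>' :: real
    assume a: "model_setting d' s' n' f0' S' N' \<sigma>' lam'"
      "real n' > 8 * tau d' s' (supnorm d' (fstar_of f0' S' s')) \<sigma>' (1 / real n') / lam'"
      "tau d' s' (supnorm d' (fstar_of f0' S' s')) \<sigma>' (1 / real n') / real n' \<le> \<gamma>'"
      "\<gamma>' < (max 0 (sqrt (lam' / 2)
                 - sqrt (tau d' s' (supnorm d' (fstar_of f0' S' s')) \<sigma>' (1 / real n') / real n')))^2"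
    interpret m: cart_model d' s' n' f0' S' N' \<sigma>' lam' "1 / real n'"
      using a(1,2) by unfold_locales (auto simp: model_setting_def)
    show "(\<integral>\<^sup>+ \<omega>. ennreal (risk d' (cart d' n' \<gamma>' (dataset (fstar_of f0' S' s') \<omega>)) (fstar_of f0' S' s'))
              \<partial>sample_space d' n' N')
          \<le> ennreal (100 * 2 ^ s' * ((supnorm d' (fstar_of f0' S' s'))^2 + \<sigma>'^2)
                       * (real s' + ln (real n')) / real n')"
      using m.expected_risk_rate[OF _ _ refl, of \<gamma>'] a(3,4)
      unfolding m.f_def[symmetric] m.B_def[symmetric] m.\<tau>_def[symmetric] by blast
  qed simp
qed

end
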